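(* Let $m\ge 2$, let $H\le\mathrm{Sym}(m)$, and let $G\le W_H$ be a self-similar subgroup. If $G$ satisfies a group law, then $G$ has Hausdorff dimension zero in $W_H$.
   Context: Let $T$ be the $m$-adic rooted tree, identified with the free monoid on $\{1,\dots,m\}$ (vertices are finite words, level $n$ consists of the words of length $n$). $\mathrm{Aut}\,T$ is the group of automorphisms of the rooted tree $T$ (acting on the right). For $g\in\mathrm{Aut}\,T$ and a vertex $v$, the section $g|_v\in\mathrm{Aut}\,T$ is defined by $(vu)^g=v^g u^{g|_v}$ for all $u\in T$; $g|_v^1\in\mathrm{Sym}(m)$ denotes the permutation of $\{1,\dots,m\}$ induced by $g|_v$ on level 1. The iterated wreath product is $W_H=\{g\in\mathrm{Aut}\,T : g|_v^1\in H \text{ for all } v\in T\}$, a profinite group whose topology has the level stabilizers as a base of neighbourhoods of $1$. A subgroup $G\le\mathrm{Aut}\,T$ is self-similar if $g|_v\in G$ for all $g\in G$, $v\in T$. For $K\le\mathrm{Aut}\,T$, $\mathrm{St}_K(n)$ is the subgroup of elements of $K$ fixing every vertex of level $n$. The group $W_H$ carries the metric $d(g,h)=\inf_{n}\{|W_H:\mathrm{St}_{W_H}(n)|^{-1} : gh^{-1}\in\mathrm{St}_{W_H}(n)\}$, and Hausdorff dimension in $W_H$ is the Hausdorff dimension of Borel subsets with respect to this metric (that is, with respect to the level-stabilizer filtration). For a closed subgroup $K\le W_H$ it is given by $\mathrm{hdim}_{W_H}(K)=\liminf_{n\to\infty}\frac{\log|K:\mathrm{St}_K(n)|}{\log|W_H:\mathrm{St}_{W_H}(n)|}$.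 A group $G$ satisfies a group law if there is a non-trivial element $w$ of a free group on finitely many generators $x_1,\dots,x_r$ such that $w(g_1,\dots,g_r)=1$ for all $g_1,\dots,g_r\in G$. *)

theory Defs
  imports
    "HOL-Algebra.Sym_Groups"
    "HOL-Analysis.Abstract_Metric_Spaces"
    "HOL-Library.Extended_Nonnegative_Real"
begin

section \<open>Automorphisms of the rooted tree\<close>

definition words :: "nat \<Rightarrow> nat list set" where
  "words m = lists {1..m}"

definition tree_adjacent :: "nat list \<Rightarrow> nat list \<Rightarrow> bool" where
  "tree_adjacent u v \<longleftrightarrow> (\<exists>x. v = u @ [x] \<or> u = v @ [x])"

text \<open>
  Automorphisms are extended by the identity outside the vertex set, as in the library's
  \<^const>\<open>sym_group\<close>. They act on the right, so the product \<open>g h\<close> means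
  first \<open>g\<close>, then \<open>h\<close>.
\<close>

definition aut_tree :: "nat \<Rightarrow> (nat list \<Rightarrow> nat list) monoid" where
  "aut_tree m = \<lparr>carrier = {g. g permutes words m \<and> g [] = [] \<and>
      (\<forall>u\<in>words m. \<forall>v\<in>words m. tree_adjacent (g u) (g v) \<longleftrightarrow> tree_adjacent u v)},
    mult = (\<lambda>g h. h \<circ> g), one = id\<rparr>"

text \<open>
  Since \<open>g\<close> preserves levels and prefixes, the word \<open>w\<close> with \<open>g (v @ u) = g v @ w\<close> is
  obtained by dropping the first \<open>length v\<close> letters; see \<open>section_append\<close> below.
\<close>

definition section_at :: "(nat list \<Rightarrow> nat list) \<Rightarrow> nat list \<Rightarrow> nat list \<Rightarrow> nat list" where
  "section_at g v = (\<lambda>u. drop (length v) (g (v @ u)))"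

definition level1_perm :: "(nat list \<Rightarrow> nat list) \<Rightarrow> nat \<Rightarrow> nat" where
  "level1_perm g = (\<lambda>x. hd (g [x]))"

definition iterated_wreath :: "nat \<Rightarrow> (nat \<Rightarrow> nat) set \<Rightarrow> (nat list \<Rightarrow> nat list) monoid" where
  "iterated_wreath m H = (aut_tree m)\<lparr>carrier :=
     {g \<in> carrier (aut_tree m). \<forall>v\<in>words m. level1_perm (section_at g v) \<in> H}\<rparr>"

definition self_similar :: "nat \<Rightarrow> (nat list \<Rightarrow> nat list) set \<Rightarrow> bool" where
  "self_similar m G \<longleftrightarrow> (\<forall>g\<in>G. \<forall>v\<in>words m. section_at g v \<in> G)"

definition level_stab ::
  "nat \<Rightarrow> (nat list \<Rightarrow> nat list) set \<Rightarrow> nat \<Rightarrow> (nat list \<Rightarrow> nat list) set" where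
  "level_stab m K n = {g \<in> K. \<forall>v\<in>words m. length v = n \<longrightarrow> g v = v}"

definition level_index :: "nat \<Rightarrow> (nat \<Rightarrow> nat) set \<Rightarrow> nat \<Rightarrow> nat" where
  "level_index m H n =
     card (rcosets\<^bsub>iterated_wreath m H\<^esub> (level_stab m (carrier (iterated_wreath m H)) n))"

text \<open>
  The value \<open>0\<close> outside the carrier is only there because \<^locale>\<open>Metric_space\<close> asks for a total
  distance function. On the diagonal of the carrier the infimum is \<open>0\<close> anyway unless \<open>H\<close> is
  trivial; in that case the group has a single element and the bare formula would give it
  distance \<open>1\<close> from itself.
\<close>

definition level_dist ::
  "nat \<Rightarrow> (nat \<Rightarrow> nat) set \<Rightarrow> (nat list \<Rightarrow> nat list) \<Rightarrow> (nat list \<Rightarrow> nat list) \<Rightarrow> real" where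
  "level_dist m H g h =
    (let W = iterated_wreath m H in
     if g \<in> carrier W \<and> h \<in> carrier W \<and> g \<noteq> h
     then Inf {inverse (real (level_index m H n)) | n.
                 g \<otimes>\<^bsub>W\<^esub> inv\<^bsub>W\<^esub> h \<in> level_stab m (carrier W) n}
     else 0)"


section \<open>Hausdorff dimension in a metric space\<close>

context Metric_space
begin

definition ediam :: "'a set \<Rightarrow> ennreal" where
  "ediam U = (SUP x\<in>U. SUP y\<in>U. ennreal (d x y))"

text \<open>The \<open>s\<close>-th power of the diameter, where \<open>0\<^sup>0 = 1\<close> except for the empty set.\<close>

definition diam_power :: "real \<Rightarrow> 'a set \<Rightarrow> ennreal" where
  "diam_power s U =
    (if U = {} then 0 else if s = 0 then 1 else ennreal (enn2real (ediam U) powr s))"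

text \<open>Finite covers are included, as members of a cover may be empty.\<close>

definition hausdorff_covers :: "real \<Rightarrow> 'a set \<Rightarrow> (nat \<Rightarrow> 'a set) set" where
  "hausdorff_covers \<delta> S =
    {U. (\<forall>i. U i \<subseteq> M \<and> ediam (U i) \<le> ennreal \<delta>) \<and> S \<subseteq> (\<Union>i. U i)}"

definition hausdorff_measure :: "real \<Rightarrow> 'a set \<Rightarrow> ennreal" where
  "hausdorff_measure s S =
    (SUP \<delta>\<in>{0<..}. INF U\<in>hausdorff_covers \<delta> S. \<Sum>i. diam_power s (U i))"

definition hausdorff_dim :: "'a set \<Rightarrow> ennreal" where
  "hausdorff_dim S = Inf {ennreal s | s. 0 \<le> s \<and> hausdorff_measure s S = 0}"

end


section \<open>Free groups and group laws\<close>

text \<open>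
  The letters \<open>(i, True)\<close> and \<open>(i, False)\<close> stand for \<open>x\<^sub>i\<close> and its inverse; elements of the free
  group are the reduced words, with concatenation followed by reduction as product.
\<close>

type_synonym letter = "nat \<times> bool"

definition letter_inv :: "letter \<Rightarrow> letter" where
  "letter_inv a = (fst a, \<not> snd a)"

definition reduced :: "letter list \<Rightarrow> bool" where
  "reduced w \<longleftrightarrow> successively (\<lambda>a b. b \<noteq> letter_inv a) w"

definition reduced_Cons :: "letter \<Rightarrow> letter list \<Rightarrow> letter list" where
  "reduced_Cons a w =
    (case w of [] \<Rightarrow> [a] | b # v \<Rightarrow> if b = letter_inv a then v else a # w)"

definition free_group :: "nat \<Rightarrow> letter list monoid" where
  "free_group r = \<lparr>carrier = {w. set w \<subseteq> {1..r} \<times> UNIV \<and> reduced w},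
    mult = foldr reduced_Cons, one = []\<rparr>"

definition word_eval :: "('a, 'b) monoid_scheme \<Rightarrow> (nat \<Rightarrow> 'a) \<Rightarrow> letter list \<Rightarrow> 'a" where
  "word_eval G f w =
    foldr (\<lambda>(i, b) y. (if b then f i else inv\<^bsub>G\<^esub> f i) \<otimes>\<^bsub>G\<^esub> y) w \<one>\<^bsub>G\<^esub>"

definition satisfies_group_law :: "('a, 'b) monoid_scheme \<Rightarrow> bool" where
  "satisfies_group_law G \<longleftrightarrow>
    (\<exists>r. \<exists>w\<in>carrier (free_group r). w \<noteq> \<one>\<^bsub>free_group r\<^esub> \<and>
       (\<forall>f\<in>{1..r} \<rightarrow> carrier G. word_eval G f w = \<one>\<^bsub>G\<^esub>))"


section \<open>Consistency of the definitions\<close>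

subsection \<open>The free group\<close>

lemma letter_inv_inv [simp]: "letter_inv (letter_inv a) = a"
  by (simp add: letter_inv_def)

lemma reduced_Nil [simp]: "reduced []"
  by (simp add: reduced_def)

lemma reduced_ConsD: "reduced (a # w) \<Longrightarrow> reduced w"
  by (cases w) (auto simp: reduced_def)

lemma reduced_reduced_Cons: "reduced w \<Longrightarrow> reduced (reduced_Cons a w)"
  by (cases w) (auto simp: reduced_Cons_def reduced_def successively_Cons)

lemma reduced_foldr: "reduced w \<Longrightarrow> reduced (foldr reduced_Cons u w)"
  by (induction u) (auto intro: reduced_reduced_Cons)

lemma set_reduced_Cons: "set (reduced_Cons a w) \<subseteq> insert a (set w)"
  by (cases w) (auto simp: reduced_Cons_def)

lemma set_foldr_reduced_Cons: "set (foldr reduced_Cons u w) \<subseteq> set u \<union> set w"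
proof (induction u)
  case (Cons a u)
  then show ?case
    using set_reduced_Cons[of a "foldr reduced_Cons u w"] by auto
qed simp

lemma reduced_Cons_cancel:
  assumes "reduced w"
  shows "reduced_Cons a (reduced_Cons (letter_inv a) w) = w"
proof (cases w)
  case (Cons b v)
  then show ?thesis
    using assms by (cases v) (auto simp: reduced_Cons_def reduced_def)
qed (simp add: reduced_Cons_def)

lemma foldr_reduced_Cons:
  assumes "reduced w"
  shows "foldr reduced_Cons (reduced_Cons a u) w = reduced_Cons a (foldr reduced_Cons u w)"
proof (cases u)
  case (Cons b v)
  then show ?thesis
    using assms reduced_Cons_cancel[OF reduced_foldr, of w a v]
    by (auto simp: reduced_Cons_def[of a "b # v"])
qed (simp add: reduced_Cons_def)

lemma foldr_reduced_assoc:
  assumes "reduced w"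
  shows "foldr reduced_Cons (foldr reduced_Cons u v) w
       = foldr reduced_Cons u (foldr reduced_Cons v w)"
  by (induction u) (simp_all add: foldr_reduced_Cons assms)

lemma foldr_reduced_Nil: "reduced u \<Longrightarrow> foldr reduced_Cons u [] = u"
proof (induction u)
  case (Cons a u)
  then have "foldr reduced_Cons u [] = u"
    using reduced_ConsD by blast
  moreover have "reduced_Cons a u = a # u"
    using Cons.prems by (cases u) (auto simp: reduced_Cons_def reduced_def)
  ultimately show ?case by simp
qed simp

lemma foldr_reduced_inverse:
  assumes "reduced w"
  shows "foldr reduced_Cons (rev (map letter_inv u)) (foldr reduced_Cons u w) = w"
  using assms
proof (induction u arbitrary: w)
  case (Cons a u)
  have "reduced_Cons (letter_inv a) (reduced_Cons a (foldr reduced_Cons u w))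
      = foldr reduced_Cons u w"
    using reduced_Cons_cancel[OF reduced_foldr, of w "letter_inv a" u] Cons.prems by simp
  then show ?case
    using Cons by simp
qed simp

lemma reduced_rev_inv:
  assumes "reduced u"
  shows "reduced (rev (map letter_inv u))"
proof -
  have "(\<lambda>x y. x \<noteq> y) = (\<lambda>x y. letter_inv x \<noteq> letter_inv y)"
    using letter_inv_inv by metis
  then show ?thesis
    using assms unfolding reduced_def successively_rev successively_map
    by (elim successively_mono) (auto simp: letter_inv_def)
qed

lemma group_free_group: "group (free_group r)"
proof (rule groupI)
  fix u v assume "u \<in> carrier (free_group r)" "v \<in> carrier (free_group r)"
  then show "u \<otimes>\<^bsub>free_group r\<^esub> v \<in> carrier (free_group r)"
    using set_foldr_reduced_Cons[of u v] by (auto simp: free_group_def reduced_foldr)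
next
  fix u assume u: "u \<in> carrier (free_group r)"
  show "\<exists>v\<in>carrier (free_group r). v \<otimes>\<^bsub>free_group r\<^esub> u = \<one>\<^bsub>free_group r\<^esub>"
  proof (rule bexI)
    show "rev (map letter_inv u) \<otimes>\<^bsub>free_group r\<^esub> u = \<one>\<^bsub>free_group r\<^esub>"
      using u foldr_reduced_inverse[of "[]" u] foldr_reduced_Nil[of u]
      by (simp add: free_group_def)
    show "rev (map letter_inv u) \<in> carrier (free_group r)"
      using u by (auto simp: free_group_def reduced_rev_inv letter_inv_def)
  qed
qed (auto simp: free_group_def foldr_reduced_assoc)

lemma (in group) word_eval_closed:
  assumes "f \<in> {1..r} \<rightarrow> carrier G" "set w \<subseteq> {1..r} \<times> UNIV"
  shows "word_eval G f w \<in> carrier G"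
  using assms(2) by (induction w) (use assms(1) in \<open>auto simp: word_eval_def Pi_iff\<close>)

lemma (in group) word_eval_hom:
  assumes f: "f \<in> {1..r} \<rightarrow> carrier G"
  shows "word_eval G f \<in> hom (free_group r) G"
proof -
  let ?e = "\<lambda>a. if snd a then f (fst a) else inv (f (fst a))"
  have ev_Cons: "word_eval G f (a # w) = ?e a \<otimes> word_eval G f w" for a w
    by (cases a) (simp add: word_eval_def)
  have ev_Nil: "word_eval G f [] = \<one>"
    by (simp add: word_eval_def)
  have e_closed: "?e a \<in> carrier G" if "a \<in> {1..r} \<times> UNIV" for a
    using that f by (auto simp: Pi_iff)
  have ev_rc: "word_eval G f (reduced_Cons a w) = ?e a \<otimes> word_eval G f w"
    if a: "a \<in> {1..r} \<times> UNIV" and w: "set w \<subseteq> {1..r} \<times> UNIV" for a w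
  proof (cases w)
    case Nil
    then show ?thesis by (simp add: reduced_Cons_def ev_Cons)
  next
    case (Cons b v)
    show ?thesis
    proof (cases "b = letter_inv a")
      case True
      have v: "word_eval G f v \<in> carrier G"
        using w Cons by (intro word_eval_closed[OF f]) auto
      have fa: "f (fst a) \<in> carrier G"
        using a f by (auto simp: Pi_iff)
      have "?e a \<otimes> (?e b \<otimes> word_eval G f v) = word_eval G f v"
        using True v fa by (auto simp: letter_inv_def m_assoc[symmetric])
      moreover have "reduced_Cons a w = v" "word_eval G f w = ?e b \<otimes> word_eval G f v"
        using True Cons by (simp_all only: ev_Cons) (simp add: reduced_Cons_def)
      ultimately show ?thesis by simp
    qed (use Cons in \<open>simp add: reduced_Cons_def ev_Cons\<close>)
  qed
  have "word_eval G f (foldr reduced_Cons u v) = word_eval G f u \<otimes> word_eval G f v"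
    if "set u \<subseteq> {1..r} \<times> UNIV" and v: "set v \<subseteq> {1..r} \<times> UNIV" for u v
    using that(1)
  proof (induction u)
    case Nil
    then show ?case using word_eval_closed[OF f v] by (simp add: ev_Nil)
  next
    case (Cons a u)
    then have "set (foldr reduced_Cons u v) \<subseteq> {1..r} \<times> UNIV"
      using set_foldr_reduced_Cons[of u v] v by auto
    then have "word_eval G f (foldr reduced_Cons (a # u) v)
        = ?e a \<otimes> (word_eval G f u \<otimes> word_eval G f v)"
      using Cons ev_rc by simp
    then show ?case
      using Cons.prems word_eval_closed[OF f v] word_eval_closed[OF f, of u] e_closed[of a]
      by (simp add: ev_Cons m_assoc)
  qed
  then show ?thesis
    using word_eval_closed[OF f] by (auto simp: hom_def free_group_def)
qed


subsection \<open>Sections and the iterated wreath product\<close>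

lemma words_append [simp]: "u @ v \<in> words m \<longleftrightarrow> u \<in> words m \<and> v \<in> words m"
  by (auto simp: words_def)

lemma words_Nil [simp]: "[] \<in> words m"
  by (simp add: words_def)

lemma aut_permutes: "g \<in> carrier (aut_tree m) \<Longrightarrow> g permutes words m"
  by (simp add: aut_tree_def)

lemma aut_in_words: "g \<in> carrier (aut_tree m) \<Longrightarrow> g v \<in> words m \<longleftrightarrow> v \<in> words m"
  using aut_permutes permutes_in_image by metis

lemma aut_adjacent:
  assumes "g \<in> carrier (aut_tree m)" "u \<in> words m" "v \<in> words m"
  shows "tree_adjacent (g u) (g v) \<longleftrightarrow> tree_adjacent u v"
  using assms by (simp add: aut_tree_def)

lemma aut_tree_snoc:
  assumes g: "g \<in> carrier (aut_tree m)" and "v @ [x] \<in> words m"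
  shows "\<exists>y. g (v @ [x]) = g v @ [y]"
  using assms(2)
proof (induction v arbitrary: x rule: rev_induct)
  case Nil
  have "tree_adjacent [] [x]" by (simp add: tree_adjacent_def)
  moreover have "g [] = []"
    using g by (simp add: aut_tree_def)
  ultimately have "tree_adjacent [] (g [x])"
    using aut_adjacent[OF g, of "[]" "[x]"] Nil by simp
  then show ?case
    using \<open>g [] = []\<close> by (simp add: tree_adjacent_def)
next
  case (snoc z v)
  let ?u = "v @ [z]"
  have "tree_adjacent ?u (?u @ [x])" by (auto simp: tree_adjacent_def)
  moreover have "tree_adjacent ?u (?u @ [x]) \<longleftrightarrow> tree_adjacent (g ?u) (g (?u @ [x]))"
    using aut_adjacent[OF g, of ?u "?u @ [x]"] snoc.prems unfolding words_append by blast
  ultimately have "tree_adjacent (g ?u) (g (?u @ [x]))" by blast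
  then consider y where "g (?u @ [x]) = g ?u @ [y]" | y where "g ?u = g (?u @ [x]) @ [y]"
    by (auto simp: tree_adjacent_def)
  then show ?case
  proof cases
    case 2
    obtain y' where "g ?u = g v @ [y']"
      using snoc.IH[of z] snoc.prems by (metis words_append)
    then have "g (?u @ [x]) = g v" using 2 by simp
    then have "?u @ [x] = v"
      using permutes_inj[OF aut_permutes[OF g]] by (metis injD)
    then show ?thesis by simp
  qed blast
qed

lemma aut_tree_length:
  assumes "g \<in> carrier (aut_tree m)" "v \<in> words m"
  shows "length (g v) = length v"
  using assms(2)
proof (induction v rule: rev_induct)
  case Nil
  then show ?case using assms(1) by (simp add: aut_tree_def)
next
  case (snoc x v)
  then show ?case using aut_tree_snoc[OF assms(1) snoc.prems] by auto
qed

lemma aut_tree_append: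
  assumes "g \<in> carrier (aut_tree m)" "v \<in> words m" "u \<in> words m"
  shows "\<exists>w. g (v @ u) = g v @ w"
  using assms(3)
proof (induction u rule: rev_induct)
  case (snoc x u)
  then show ?case
    using aut_tree_snoc[OF assms(1), of "v @ u" x] assms(2) by auto
qed simp

lemma section_append:
  assumes "g \<in> carrier (aut_tree m)" "v \<in> words m" "u \<in> words m"
  shows "g (v @ u) = g v @ section_at g v u"
  using aut_tree_append[OF assms] aut_tree_length[OF assms(1,2)]
  by (auto simp: section_at_def)

lemma section_in_aut_tree:
  assumes g: "g \<in> carrier (aut_tree m)" and v: "v \<in> words m"
  shows "section_at g v \<in> carrier (aut_tree m)"
proof -
  let ?s = "section_at g v"
  note app = section_append[OF g v]
  have closed: "?s u \<in> words m" if "u \<in> words m" for u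
    using app[OF that] aut_in_words[OF g, of "v @ u"] v that by simp
  have out: "?s u = u" if "u \<notin> words m" for u
    using permutes_not_in[OF aut_permutes[OF g], of "v @ u"] that by (simp add: section_at_def)
  have "inj_on ?s (words m)"
    by (rule inj_onI) (metis app injD permutes_inj[OF aut_permutes[OF g]] same_append_eq)
  moreover have "\<exists>u\<in>words m. ?s u = w" if w: "w \<in> words m" for w
  proof -
    obtain t where t: "g t = g v @ w"
      using permutes_surj[OF aut_permutes[OF g]] by (metis surjD)
    then have tw: "t \<in> words m"
      using aut_in_words[OF g] v w by (metis words_append)
    have len: "length v \<le> length t"
      using aut_tree_length[OF g tw] aut_tree_length[OF g v] t by simp
    define t1 t2 where "t1 = take (length v) t" and "t2 = drop (length v) t"
    have split: "t = t1 @ t2" by (simp add: t1_def t2_def)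
    then have t12: "t1 \<in> words m" "t2 \<in> words m"
      using tw by auto
    have "g t = g t1 @ section_at g t1 t2"
      using section_append[OF g t12] split by simp
    moreover have "length (g t1) = length (g v)"
      using aut_tree_length[OF g] t12(1) v len by (simp add: t1_def)
    ultimately have "g t1 = g v"
      using t by simp
    then have "t1 = v"
      using permutes_inj[OF aut_permutes[OF g]] by (metis injD)
    then have "?s t2 = w"
      using app[OF t12(2)] split t by simp
    then show ?thesis using t12 by blast
  qed
  ultimately have "bij_betw ?s (words m) (words m)"
    using closed by (auto simp: bij_betw_def)
  then have perm: "?s permutes words m"
    using out by (intro bij_imp_permutes) auto
  have "?s [] = []"
    using app[of "[]"] by simp
  moreover have "tree_adjacent (?s u) (?s w) \<longleftrightarrow> tree_adjacent u w"
    if "u \<in> words m" "w \<in> words m" for u w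
  proof -
    have adj: "tree_adjacent (t @ a) (t @ b) \<longleftrightarrow> tree_adjacent a b" for t a b
      by (simp add: tree_adjacent_def)
    have "tree_adjacent (?s u) (?s w) \<longleftrightarrow> tree_adjacent (g (v @ u)) (g (v @ w))"
      by (simp add: app that adj)
    also have "\<dots> \<longleftrightarrow> tree_adjacent (v @ u) (v @ w)"
      using aut_adjacent[OF g] v that by simp
    finally show ?thesis by (simp add: adj)
  qed
  ultimately show ?thesis
    using perm by (simp add: aut_tree_def)
qed

lemma level1_permutes:
  assumes g: "g \<in> carrier (aut_tree m)"
  shows "level1_perm g permutes {1..m}"
proof (rule bij_imp_permutes)
  have sing: "\<exists>y\<in>{1..m}. g [x] = [y]" if "x \<in> {1..m}" for x
  proof -
    have x: "[x] \<in> words m" using that by (simp add: words_def)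
    then show ?thesis
      using aut_tree_length[OF g x] aut_in_words[OF g, of "[x]"]
      by (auto simp: words_def length_Suc_conv)
  qed
  have "inj_on (level1_perm g) {1..m}"
  proof (rule inj_onI)
    fix x y assume "x \<in> {1..m}" "y \<in> {1..m}" "level1_perm g x = level1_perm g y"
    then have "g [x] = g [y]"
      using sing[of x] sing[of y] by (auto simp: level1_perm_def)
    then show "x = y"
      using permutes_inj[OF aut_permutes[OF g]] by (auto dest: injD)
  qed
  moreover have "level1_perm g ` {1..m} \<subseteq> {1..m}"
    using sing by (fastforce simp: level1_perm_def)
  ultimately show "bij_betw (level1_perm g) {1..m} {1..m}"
    by (simp add: bij_betw_def endo_inj_surj)
next
  fix x assume "x \<notin> {1..m}"
  then have "g [x] = [x]"
    by (intro permutes_not_in[OF aut_permutes[OF g]]) (auto simp: words_def)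
  then show "level1_perm g x = x"
    by (simp add: level1_perm_def)
qed

lemma inv_in_aut_tree:
  assumes g: "g \<in> carrier (aut_tree m)"
  shows "inv' g \<in> carrier (aut_tree m)"
proof -
  have perm: "g permutes words m"
    by (rule aut_permutes[OF g])
  have iw: "inv' g u \<in> words m" if "u \<in> words m" for u
    using permutes_in_image[OF permutes_inv[OF perm]] that by blast
  have gi: "g (inv' g u) = u" for u
    by (rule permutes_inverses(1)[OF perm])
  have "inv' g [] = []"
    using g perm by (simp add: aut_tree_def permutes_inv_eq)
  moreover have "tree_adjacent (inv' g u) (inv' g v) \<longleftrightarrow> tree_adjacent u v"
    if "u \<in> words m" "v \<in> words m" for u v
  proof -
    have "\<forall>u\<in>words m. \<forall>v\<in>words m. tree_adjacent (g u) (g v) \<longleftrightarrow> tree_adjacent u v"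
      using g by (simp add: aut_tree_def)
    from this[rule_format, OF iw[OF that(1)] iw[OF that(2)]] show ?thesis
      by (simp add: gi)
  qed
  ultimately show ?thesis
    using permutes_inv[OF perm] by (simp add: aut_tree_def)
qed

lemma group_aut_tree: "group (aut_tree m)"
proof (rule groupI)
  fix g h assume gh: "g \<in> carrier (aut_tree m)" "h \<in> carrier (aut_tree m)"
  then show "g \<otimes>\<^bsub>aut_tree m\<^esub> h \<in> carrier (aut_tree m)"
    using aut_in_words[OF gh(1)] by (auto simp: aut_tree_def permutes_compose)
next
  show "\<one>\<^bsub>aut_tree m\<^esub> \<in> carrier (aut_tree m)"
    by (simp add: aut_tree_def permutes_id)
next
  fix g assume g: "g \<in> carrier (aut_tree m)"
  have "inv' g \<otimes>\<^bsub>aut_tree m\<^esub> g = \<one>\<^bsub>aut_tree m\<^esub>"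
    using permutes_inv_o(1)[OF aut_permutes[OF g]] by (simp add: aut_tree_def)
  then show "\<exists>h\<in>carrier (aut_tree m). h \<otimes>\<^bsub>aut_tree m\<^esub> g = \<one>\<^bsub>aut_tree m\<^esub>"
    using inv_in_aut_tree[OF g] by blast
qed (auto simp: aut_tree_def comp_assoc)

lemma inv_aut_tree:
  assumes "g \<in> carrier (aut_tree m)"
  shows "inv\<^bsub>aut_tree m\<^esub> g = inv' g"
  by (rule group.inv_equality[OF group_aut_tree _ assms inv_in_aut_tree[OF assms]])
    (use permutes_inv_o(1)[OF aut_permutes[OF assms]] in \<open>simp add: aut_tree_def\<close>)

lemma subgroup_iterated_wreath:
  assumes H: "subgroup H (sym_group m)"
  shows "subgroup (carrier (iterated_wreath m H)) (aut_tree m)"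
proof -
  have mult: "p \<circ> q \<in> H" if "p \<in> H" "q \<in> H" for p q
    using subgroup.m_closed[OF H that] by (simp add: sym_group_def)
  have one: "id \<in> H"
    using subgroup.one_closed[OF H] by (simp add: sym_group_def)
  have Hp: "p permutes {1..m}" if "p \<in> H" for p
    using subgroup.subset[OF H] that by (auto simp: sym_group_def)
  have inv: "inv' p \<in> H" if "p \<in> H" for p
  proof -
    have "inv\<^bsub>sym_group m\<^esub> p = inv' p"
      using Hp[OF that]
      by (intro group.inv_equality[OF sym_group_is_group])
        (auto simp: sym_group_def permutes_inv permutes_inv_o)
    then show ?thesis using subgroup.m_inv_closed[OF H that] by simp
  qed
  have sec_comp: "section_at (h \<circ> g) v = section_at h (g v) \<circ> section_at g v"
    if g: "g \<in> carrier (aut_tree m)" and h: "h \<in> carrier (aut_tree m)"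
      and v: "v \<in> words m" for g h v
  proof
    fix u
    show "section_at (h \<circ> g) v u = (section_at h (g v) \<circ> section_at g v) u"
    proof (cases "u \<in> words m")
      case True
      then show ?thesis
        using section_append[OF g v True] aut_tree_length[OF g v]
        by (simp add: section_at_def)
    next
      case False
      have "v @ u \<notin> words m" "g v @ u \<notin> words m" using False by auto
      then show ?thesis
        using False permutes_not_in[OF aut_permutes[OF g]] permutes_not_in[OF aut_permutes[OF h]]
          aut_tree_length[OF g v]
        by (simp add: section_at_def)
    qed
  qed
  have l1_comp: "level1_perm (h \<circ> g) = level1_perm h \<circ> level1_perm g"
    if g: "g \<in> carrier (aut_tree m)" for g h
  proof
    fix x
    have "\<exists>y. g [x] = [y]"
    proof (cases "[x] \<in> words m")
      case True
      then show ?thesis using aut_tree_length[OF g True] by (simp add: length_Suc_conv)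
    next
      case False
      then show ?thesis using permutes_not_in[OF aut_permutes[OF g]] by blast
    qed
    then show "level1_perm (h \<circ> g) x = (level1_perm h \<circ> level1_perm g) x"
      by (auto simp: level1_perm_def)
  qed
  show ?thesis
  proof (rule group.subgroupI[OF group_aut_tree])
    show "carrier (iterated_wreath m H) \<subseteq> carrier (aut_tree m)"
      by (auto simp: iterated_wreath_def)
    have "id \<in> carrier (aut_tree m)"
      using group.is_monoid[OF group_aut_tree, THEN monoid.one_closed] by (simp add: aut_tree_def)
    moreover have "level1_perm (section_at id v) = id" for v
      by (auto simp: level1_perm_def section_at_def)
    ultimately have "id \<in> carrier (iterated_wreath m H)"
      using one by (simp add: iterated_wreath_def)
    then show "carrier (iterated_wreath m H) \<noteq> {}" by blast
  next
    fix g h assume "g \<in> carrier (iterated_wreath m H)" "h \<in> carrier (iterated_wreath m H)"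
    then have g: "g \<in> carrier (aut_tree m)" "\<And>v. v \<in> words m \<Longrightarrow> level1_perm (section_at g v) \<in> H"
      and h: "h \<in> carrier (aut_tree m)" "\<And>v. v \<in> words m \<Longrightarrow> level1_perm (section_at h v) \<in> H"
      by (auto simp: iterated_wreath_def)
    have "h \<circ> g \<in> carrier (aut_tree m)"
      using monoid.m_closed[OF group.is_monoid[OF group_aut_tree] g(1) h(1)]
      by (simp add: aut_tree_def)
    moreover have "level1_perm (section_at (h \<circ> g) v) \<in> H" if "v \<in> words m" for v
      using that g h aut_in_words[OF g(1)]
      by (simp add: sec_comp l1_comp section_in_aut_tree mult)
    ultimately show "g \<otimes>\<^bsub>aut_tree m\<^esub> h \<in> carrier (iterated_wreath m H)"
      by (simp add: iterated_wreath_def aut_tree_def)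
  next
    fix g assume "g \<in> carrier (iterated_wreath m H)"
    then have g: "g \<in> carrier (aut_tree m)" "\<And>v. v \<in> words m \<Longrightarrow> level1_perm (section_at g v) \<in> H"
      by (auto simp: iterated_wreath_def)
    have i: "inv' g \<in> carrier (aut_tree m)"
      by (rule inv_in_aut_tree[OF g(1)])
    have "level1_perm (section_at (inv' g) v) \<in> H" if v: "v \<in> words m" for v
    proof -
      let ?w = "inv' g v"
      have w: "?w \<in> words m" using aut_in_words[OF i] v by simp
      have "section_at (g \<circ> inv' g) v = section_at g ?w \<circ> section_at (inv' g) v"
        by (rule sec_comp[OF i g(1) v])
      then have "level1_perm (section_at g ?w) \<circ> level1_perm (section_at (inv' g) v) = id"
        using l1_comp[OF section_in_aut_tree[OF i v], of "section_at g ?w"]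
          permutes_inv_o(1)[OF aut_permutes[OF g(1)]]
        by (auto simp: level1_perm_def section_at_def fun_eq_iff)
      then have "level1_perm (section_at (inv' g) v) = inv' (level1_perm (section_at g ?w))"
        using Hp[OF g(2)[OF w]] by (metis comp_assoc comp_id fun.map_id permutes_inv_o(2) id_comp)
      then show ?thesis using inv g(2)[OF w] by simp
    qed
    then show "inv\<^bsub>aut_tree m\<^esub> g \<in> carrier (iterated_wreath m H)"
      using i by (simp add: iterated_wreath_def inv_aut_tree[OF g(1)])
  qed
qed

lemma group_iterated_wreath:
  assumes "subgroup H (sym_group m)"
  shows "group (iterated_wreath m H)"
  using subgroup.subgroup_is_group[OF subgroup_iterated_wreath[OF assms] group_aut_tree]
  by (simp add: iterated_wreath_def)


subsection \<open>The metric on the iterated wreath product\<close>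

lemma level_stab_antimono:
  assumes K: "K \<subseteq> carrier (aut_tree m)" and "1 \<le> m" "k \<le> n"
  shows "level_stab m K n \<subseteq> level_stab m K k"
proof
  fix g assume "g \<in> level_stab m K n"
  then have g: "g \<in> K" "\<And>v. v \<in> words m \<Longrightarrow> length v = n \<Longrightarrow> g v = v"
    by (auto simp: level_stab_def)
  have "g v = v" if v: "v \<in> words m" "length v = k" for v
  proof -
    let ?u = "replicate (n - k) 1"
    have u: "?u \<in> words m" using \<open>1 \<le> m\<close> by (auto simp: words_def in_lists_conv_set)
    then have "g (v @ ?u) = v @ ?u"
      using v \<open>k \<le> n\<close> by (intro g(2)) auto
    then show ?thesis
      using section_append[of g m v ?u] g(1) K v u aut_tree_length[of g m v] by auto
  qed
  then show "g \<in> level_stab m K k" using g(1) by (simp add: level_stab_def)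
qed

lemma finite_level: "finite {v \<in> words m. length v = n}"
  by (rule finite_subset[OF _ finite_lists_length_eq[of "{1..m}" n]]) (auto simp: words_def)

lemma level_index_pos:
  assumes H: "subgroup H (sym_group m)"
  shows "0 < level_index m H n"
proof -
  interpret W: group "iterated_wreath m H"
    by (rule group_iterated_wreath[OF H])
  let ?W = "iterated_wreath m H"
  let ?S = "level_stab m (carrier ?W) n"
  let ?L = "{v \<in> words m. length v = n}"
  have aut: "g \<in> carrier (aut_tree m)" if "g \<in> carrier ?W" for g
    using that by (simp add: iterated_wreath_def)
  have mult: "s \<otimes>\<^bsub>?W\<^esub> g = g \<circ> s" for s g
    by (simp add: iterated_wreath_def aut_tree_def)
  have coset: "?S #>\<^bsub>?W\<^esub> g = {h \<in> carrier ?W. restrict h ?L = restrict g ?L}"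
    if g: "g \<in> carrier ?W" for g
  proof (intro Set.set_eqI iffI)
    fix h assume "h \<in> ?S #>\<^bsub>?W\<^esub> g"
    then obtain s where s: "s \<in> carrier ?W" "\<forall>v\<in>?L. s v = v" "h = s \<otimes>\<^bsub>?W\<^esub> g"
      by (auto simp: r_coset_def level_stab_def)
    then show "h \<in> {h \<in> carrier ?W. restrict h ?L = restrict g ?L}"
      using g W.m_closed[of s g] by (auto simp: mult intro!: restrict_ext)
  next
    fix h assume "h \<in> {h \<in> carrier ?W. restrict h ?L = restrict g ?L}"
    then have h: "h \<in> carrier ?W" and eq: "restrict h ?L = restrict g ?L"
      by blast+
    have hg: "h v = g v" if "v \<in> ?L" for v
      using fun_cong[OF eq, of v] that by simp
    let ?s = "h \<otimes>\<^bsub>?W\<^esub> inv\<^bsub>?W\<^esub> g"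
    have sg: "?s \<otimes>\<^bsub>?W\<^esub> g = h"
      using g h(1) by (simp add: W.m_assoc)
    then have "g \<circ> ?s = h"
      by (simp only: mult)
    then have "g (?s v) = h v" for v
      by (metis comp_apply)
    then have "?s v = v" if "v \<in> ?L" for v
      using hg[OF that] permutes_inj[OF aut_permutes[OF aut[OF g]]] by (metis injD)
    moreover have "?s \<in> carrier ?W"
      using g h(1) by simp
    ultimately have "?s \<in> ?S"
      unfolding level_stab_def by blast
    then show "h \<in> ?S #>\<^bsub>?W\<^esub> g"
      unfolding r_coset_def by (intro UN_I[of ?s]) (simp_all only: sg singleton_iff)
  qed
  have "(\<lambda>g. restrict g ?L) ` carrier ?W \<subseteq> ?L \<rightarrow>\<^sub>E ?L"
  proof
    fix r assume "r \<in> (\<lambda>g. restrict g ?L) ` carrier ?W"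
    then obtain g where g: "g \<in> carrier ?W" "r = restrict g ?L" by blast
    have "g v \<in> ?L" if "v \<in> ?L" for v
      using that aut_in_words[OF aut[OF g(1)], of v] aut_tree_length[OF aut[OF g(1)], of v] by simp
    then show "r \<in> ?L \<rightarrow>\<^sub>E ?L"
      unfolding g(2) restrict_PiE_iff by blast
  qed
  then have "finite ((\<lambda>g. restrict g ?L) ` carrier ?W)"
    by (rule finite_subset) (simp add: finite_PiE finite_level)
  then have "finite ((\<lambda>r. {h \<in> carrier ?W. restrict h ?L = r}) ` (\<lambda>g. restrict g ?L) ` carrier ?W)"
    by (rule finite_imageI)
  moreover have "rcosets\<^bsub>?W\<^esub> ?S
      \<subseteq> (\<lambda>r. {h \<in> carrier ?W. restrict h ?L = r}) ` (\<lambda>g. restrict g ?L) ` carrier ?W"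
    using coset by (auto simp: RCOSETS_def)
  ultimately have "finite (rcosets\<^bsub>?W\<^esub> ?S)"
    by (rule rev_finite_subset)
  moreover have "rcosets\<^bsub>?W\<^esub> ?S \<noteq> {}"
    using W.one_closed by (auto simp: RCOSETS_def)
  ultimately show ?thesis
    by (simp add: level_index_def card_gt_0_iff)
qed

lemma subgroup_level_stab:
  assumes H: "subgroup H (sym_group m)"
  shows "subgroup (level_stab m (carrier (iterated_wreath m H)) n) (iterated_wreath m H)"
proof -
  interpret W: group "iterated_wreath m H"
    by (rule group_iterated_wreath[OF H])
  let ?W = "iterated_wreath m H"
  have mult: "s \<otimes>\<^bsub>?W\<^esub> g = g \<circ> s" "\<one>\<^bsub>?W\<^esub> = id" for s g
    by (simp_all add: iterated_wreath_def aut_tree_def)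
  show ?thesis
  proof (rule W.subgroupI)
    show "level_stab m (carrier ?W) n \<noteq> {}"
      using W.one_closed mult by (auto simp: level_stab_def)
  next
    fix g assume g: "g \<in> level_stab m (carrier ?W) n"
    then have "inv\<^bsub>?W\<^esub> g \<circ> g = id"
      using W.r_inv[of g] mult by (simp add: level_stab_def)
    then have "(inv\<^bsub>?W\<^esub> g) (g v) = v" for v
      by (metis comp_apply id_apply)
    then show "inv\<^bsub>?W\<^esub> g \<in> level_stab m (carrier ?W) n"
      using g unfolding level_stab_def by (smt (verit) W.inv_closed mem_Collect_eq)
  next
    fix g h assume "g \<in> level_stab m (carrier ?W) n" "h \<in> level_stab m (carrier ?W) n"
    then show "g \<otimes>\<^bsub>?W\<^esub> h \<in> level_stab m (carrier ?W) n"
      using W.m_closed[of g h] by (auto simp: level_stab_def mult)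
  qed (auto simp: level_stab_def)
qed

lemma Metric_space_level_dist:
  assumes m: "1 \<le> m" and H: "subgroup H (sym_group m)"
  shows "Metric_space (carrier (iterated_wreath m H)) (level_dist m H)"
proof -
  interpret W: group "iterated_wreath m H"
    by (rule group_iterated_wreath[OF H])
  let ?W = "iterated_wreath m H"
  let ?S = "level_stab m (carrier ?W)"
  let ?D = "\<lambda>g h. {inverse (real (level_index m H n)) | n. g \<otimes>\<^bsub>?W\<^esub> inv\<^bsub>?W\<^esub> h \<in> ?S n}"
  note sub = subgroup_level_stab[OF H]
  have dist: "level_dist m H g h = Inf (?D g h)"
    if "g \<in> carrier ?W" "h \<in> carrier ?W" "g \<noteq> h" for g h
    using that unfolding level_dist_def Let_def by simp
  have mult: "s \<otimes>\<^bsub>?W\<^esub> g = g \<circ> s" "\<one>\<^bsub>?W\<^esub> = id" for s g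
    by (simp_all add: iterated_wreath_def aut_tree_def)
  have aut: "g \<in> carrier (aut_tree m)" if "g \<in> carrier ?W" for g
    using that by (simp add: iterated_wreath_def)
  have sub_aut: "carrier ?W \<subseteq> carrier (aut_tree m)"
    using aut by blast
  have nonneg: "0 \<le> x" if "x \<in> ?D g h" for x g h
    using that by auto
  have bdd: "bdd_below (?D g h)" for g h
    using nonneg by (meson bdd_below.I)
  have S0: "g \<in> ?S 0" if "g \<in> carrier ?W" for g
    using that aut[OF that] by (simp add: level_stab_def aut_tree_def)
  have nonempty: "?D g h \<noteq> {}" if "g \<in> carrier ?W" "h \<in> carrier ?W" for g h
    using S0[of "g \<otimes>\<^bsub>?W\<^esub> inv\<^bsub>?W\<^esub> h"] that by blast
  have ge0: "0 \<le> level_dist m H g h" for g h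
  proof (cases "g \<in> carrier ?W \<and> h \<in> carrier ?W \<and> g \<noteq> h")
    case True
    then show ?thesis
      using cInf_greatest[OF nonempty[of g h] nonneg] by (simp add: dist)
  qed (auto simp: level_dist_def)
  have sym: "?D g h \<subseteq> ?D h g" if gh: "g \<in> carrier ?W" "h \<in> carrier ?W" for g h
  proof -
    have "inv\<^bsub>?W\<^esub> (g \<otimes>\<^bsub>?W\<^esub> inv\<^bsub>?W\<^esub> h) = h \<otimes>\<^bsub>?W\<^esub> inv\<^bsub>?W\<^esub> g"
      using gh by (simp add: W.inv_mult_group)
    then have "h \<otimes>\<^bsub>?W\<^esub> inv\<^bsub>?W\<^esub> g \<in> ?S n" if "g \<otimes>\<^bsub>?W\<^esub> inv\<^bsub>?W\<^esub> h \<in> ?S n" for n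
      using subgroup.m_inv_closed[OF sub that] by simp
    then show ?thesis by blast
  qed
  show ?thesis
  proof
    show "0 \<le> level_dist m H g h" for g h
      by (rule ge0)
    show "level_dist m H g h = level_dist m H h g" for g h
    proof (cases "g \<in> carrier ?W \<and> h \<in> carrier ?W \<and> g \<noteq> h")
      case True
      then have "?D g h = ?D h g" using sym[of g h] sym[of h g] by blast
      then show ?thesis using True dist[of g h] dist[of h g] by metis
    qed (auto simp: level_dist_def)
  next
    fix g h assume gh: "g \<in> carrier ?W" "h \<in> carrier ?W"
    have "0 < level_dist m H g h" if ne: "g \<noteq> h"
    proof -
      let ?k = "g \<otimes>\<^bsub>?W\<^esub> inv\<^bsub>?W\<^esub> h"
      have k: "?k \<in> carrier ?W" using gh by simp
      have "?k \<noteq> id"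
      proof
        assume "?k = id"
        then have "?k \<otimes>\<^bsub>?W\<^esub> h = h"
          by (simp only: mult comp_id)
        moreover have "?k \<otimes>\<^bsub>?W\<^esub> h = g"
          using gh by (simp add: W.m_assoc)
        ultimately show False using ne by simp
      qed
      then obtain v where v: "?k v \<noteq> v" by (metis eq_id_iff)
      then have vw: "v \<in> words m"
        using permutes_not_in[OF aut_permutes[OF aut[OF k]]] by blast
      have small: "n < length v" if "?k \<in> ?S n" for n
      proof (rule ccontr)
        assume "\<not> n < length v"
        then have "?k \<in> ?S (length v)"
          using level_stab_antimono[OF sub_aut m, of "length v" n] that by auto
        then show False using v vw by (simp add: level_stab_def)
      qed
      have "?D g h \<subseteq> (\<lambda>n. inverse (real (level_index m H n))) ` {..<length v}"
        using small by auto
      then have fin: "finite (?D g h)"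
        by (rule finite_subset) simp
      have "Inf (?D g h) = Min (?D g h)"
        by (rule cInf_eq_Min[OF fin nonempty[OF gh]])
      then have "Inf (?D g h) \<in> ?D g h"
        using Min_in[OF fin nonempty[OF gh]] by (simp only:)
      then obtain n where "Inf (?D g h) = inverse (real (level_index m H n))"
        by blast
      then show ?thesis
        using level_index_pos[OF H, of n] dist[OF gh ne] by simp
    qed
    moreover have "level_dist m H g g = 0"
      by (simp add: level_dist_def)
    ultimately show "level_dist m H g h = 0 \<longleftrightarrow> g = h"
      by (metis less_irrefl)
  next
    fix f g h assume fgh: "f \<in> carrier ?W" "g \<in> carrier ?W" "h \<in> carrier ?W"
    show "level_dist m H f h \<le> level_dist m H f g + level_dist m H g h"
    proof (cases "f = g \<or> g = h \<or> f = h")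
      case True
      then show ?thesis
        using ge0[of f g] ge0[of g h] by (auto simp: level_dist_def)
    next
      case False
      have le: "Inf (?D f h) \<le> x + y" if xD: "x \<in> ?D f g" and yD: "y \<in> ?D g h" for x y
      proof -
        obtain a b where a: "f \<otimes>\<^bsub>?W\<^esub> inv\<^bsub>?W\<^esub> g \<in> ?S a" "x = inverse (real (level_index m H a))"
          using xD by blast
        obtain b where b: "g \<otimes>\<^bsub>?W\<^esub> inv\<^bsub>?W\<^esub> h \<in> ?S b" "y = inverse (real (level_index m H b))"
          using yD by blast
        define c where "c = min a b"
        have "f \<otimes>\<^bsub>?W\<^esub> inv\<^bsub>?W\<^esub> g \<in> ?S c" "g \<otimes>\<^bsub>?W\<^esub> inv\<^bsub>?W\<^esub> h \<in> ?S c"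
          using a(1) b(1) level_stab_antimono[OF sub_aut m, of c a]
            level_stab_antimono[OF sub_aut m, of c b] by (auto simp: c_def)
        then have "(f \<otimes>\<^bsub>?W\<^esub> inv\<^bsub>?W\<^esub> g) \<otimes>\<^bsub>?W\<^esub> (g \<otimes>\<^bsub>?W\<^esub> inv\<^bsub>?W\<^esub> h) \<in> ?S c"
          by (rule subgroup.m_closed[OF sub])
        moreover have "(f \<otimes>\<^bsub>?W\<^esub> inv\<^bsub>?W\<^esub> g) \<otimes>\<^bsub>?W\<^esub> (g \<otimes>\<^bsub>?W\<^esub> inv\<^bsub>?W\<^esub> h)
            = (f \<otimes>\<^bsub>?W\<^esub> inv\<^bsub>?W\<^esub> g \<otimes>\<^bsub>?W\<^esub> g) \<otimes>\<^bsub>?W\<^esub> inv\<^bsub>?W\<^esub> h"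
          by (simp only: W.m_assoc W.m_closed W.inv_closed fgh)
        moreover have "f \<otimes>\<^bsub>?W\<^esub> inv\<^bsub>?W\<^esub> g \<otimes>\<^bsub>?W\<^esub> g = f"
          using fgh by (simp add: W.m_assoc)
        ultimately have "f \<otimes>\<^bsub>?W\<^esub> inv\<^bsub>?W\<^esub> h \<in> ?S c"
          by simp
        then have "inverse (real (level_index m H c)) \<in> ?D f h"
          by blast
        then have "Inf (?D f h) \<le> inverse (real (level_index m H c))"
          by (rule cInf_lower[OF _ bdd])
        also have "\<dots> \<le> x + y"
          using a(2) b(2) by (auto simp: c_def min_def)
        finally show ?thesis .
      qed
      have *: "Inf (?D f h) - y \<le> Inf (?D f g)" if "y \<in> ?D g h" for y
      proof (rule cInf_greatest[OF nonempty[OF fgh(1,2)]])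
        show "Inf (?D f h) - y \<le> x" if "x \<in> ?D f g" for x
          using le[OF that \<open>y \<in> ?D g h\<close>] by linarith
      qed
      then have "Inf (?D f h) - Inf (?D f g) \<le> y" if "y \<in> ?D g h" for y
        using *[OF that] by linarith
      then have "Inf (?D f h) - Inf (?D f g) \<le> Inf (?D g h)"
        by (rule cInf_greatest[OF nonempty[OF fgh(2,3)]])
      then show ?thesis
        using dist[OF fgh(1,2)] dist[OF fgh(2,3)] dist[OF fgh(1,3)] False by linarith
    qed
  qed
qed

end

theory Submission
  imports Defs
begin

text \<open>
  Let \<open>Q n = quot n\<close> be the finite group of truncations of \<open>G\<close> to the levels up to \<open>n\<close>. By
  self-similarity \<open>|Q (n + j)| \<le> |Q n| |Q j|\<^bsup>m^n\<^esup>\<close>, so \<open>log |Q n| / m^n\<close> converges to some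
  \<open>\<mu>\<close>; the dimension is \<open>0\<close> once \<open>\<mu> = 0\<close>, because truncation classes cover \<open>G\<close>.

  Suppose \<open>\<mu> > 0\<close>. For a reduced word \<open>w \<noteq> 1\<close> in \<open>r\<close> letters, the probability \<open>p n\<close> that \<open>w\<close>, evaluated
  at a random tuple of \<open>Q n\<close>, fixes a random vertex of level \<open>n\<close> decreases to a limit \<open>p\<close>, and \<open>p = 0\<close> by
  induction on the length of \<open>w\<close>. If \<open>p > 0\<close>, fix \<open>j\<close> and let \<open>n\<close> be large. With probability at least
  \<open>p / 2\<close> the vertex \<open>v\<close> is fixed; its orbit along \<open>w\<close> has no repetition, since a repetition
  means that a shorter subword has a fixed point; and \<open>w\<close> has trivial section at \<open>v\<close> on \<open>j\<close> more
  levels, since otherwise \<open>p (n + j)\<close> would drop below \<open>p\<close>. Each such \<open>v\<close> determines the section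
  of one generator at one vertex by the other sections, and a positive proportion \<open>c\<close> of the level
  carries such \<open>v\<close> with disjoint orbits. Hence, up to lower order terms,
  \<open>r log |Q (n + j)| \<le> (r - c) m^n log |Q j|\<close>, which contradicts \<open>\<mu> > 0\<close>. A law has \<open>p = 1\<close>.
\<close>

section \<open>Words acting on levels and truncations\<close>

definition level :: "nat \<Rightarrow> nat \<Rightarrow> nat list set" where
  "level m n = {v \<in> words m. length v = n}"

text \<open>Words longer than \<open>n\<close> are fixed even where their prefixes move, so a
  truncation is no tree automorphism. In exchange the quotient of \<open>G\<close> by its stabilizer
  of level \<open>n\<close> becomes a finite set of plain functions under composition.\<close>

definition trunc :: "nat \<Rightarrow> (nat list \<Rightarrow> nat list) \<Rightarrow> nat list \<Rightarrow> nat list" where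
  "trunc n g = (\<lambda>v. if length v \<le> n then g v else v)"

definition letter_act :: "(nat \<Rightarrow> 'a \<Rightarrow> 'a) \<Rightarrow> letter \<Rightarrow> 'a \<Rightarrow> 'a" where
  "letter_act f a = (if snd a then f (fst a) else inv' (f (fst a)))"

text \<open>\<open>fold\<close> lets the first letter act first, in accordance with the right
  action.\<close>

definition walk :: "(nat \<Rightarrow> 'a \<Rightarrow> 'a) \<Rightarrow> letter list \<Rightarrow> 'a \<Rightarrow> 'a" where
  "walk f w = fold (letter_act f) w"

lemma walk_Nil [simp]: "walk f [] = id"
  and walk_Cons: "walk f (a # w) = walk f w \<circ> letter_act f a"
  and walk_append: "walk f (u @ w) = walk f w \<circ> walk f u"
  by (auto simp: walk_def)

lemma walk_take_Suc: "t < length w \<Longrightarrow> walk f (take (Suc t) w) v = letter_act f (w ! t) (walk f (take t w) v)"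
  by (simp add: take_Suc_conv_app_nth walk_append walk_Cons)

lemma finite_level_set [simp]: "finite (level m n)"
  using finite_level by (simp add: level_def)

lemma card_level: "card (level m n) = m ^ n"
proof -
  have "level m n = {xs. set xs \<subseteq> {1..m} \<and> length xs = n}"
    by (auto simp: level_def words_def)
  then show ?thesis by (simp add: card_lists_length_eq)
qed

lemma level_append:
  "y \<in> level m (n + j) \<longleftrightarrow> (\<exists>x\<in>level m n. \<exists>u\<in>level m j. y = x @ u)"
proof
  assume "y \<in> level m (n + j)"
  then have "take n y \<in> level m n" "drop n y \<in> level m j"
    unfolding level_def words_def by (auto dest: in_set_takeD in_set_dropD)
  then show "\<exists>x\<in>level m n. \<exists>u\<in>level m j. y = x @ u"
    by (metis append_take_drop_id)
qed (auto simp: level_def)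

lemma aut_length: "g \<in> carrier (aut_tree m) \<Longrightarrow> length (g v) = length v"
  using aut_tree_length aut_permutes permutes_not_in by metis

lemma aut_level: "g \<in> carrier (aut_tree m) \<Longrightarrow> g v \<in> level m n \<longleftrightarrow> v \<in> level m n"
  by (simp add: level_def aut_in_words aut_length)

lemma trunc_trunc: "trunc k (trunc n g) = trunc (min k n) g"
  by (auto simp: trunc_def)

lemma trunc_id [simp]: "trunc n id = id"
  by (auto simp: trunc_def)

lemma trunc_comp:
  assumes "\<And>v. length (g v) = length v"
  shows "trunc n (h \<circ> g) = trunc n h \<circ> trunc n g"
  using assms by (auto simp: trunc_def)

lemma trunc_inv:
  assumes l: "\<And>v. length (g v) = length v" and b: "bij g"
  shows "inv' (trunc n g) = trunc n (inv' g)" and "bij (trunc n g)"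
proof -
  have l': "length (inv' g v) = length v" for v
    using l b by (metis bij_inv_eq_iff)
  have 1: "trunc n (inv' g) \<circ> trunc n g = id"
    using trunc_comp[OF l, of n "inv' g"] b by (simp add: bij_is_inj)
  have 2: "trunc n g \<circ> trunc n (inv' g) = id"
    using trunc_comp[OF l', of n g] b by (metis bij_is_surj surj_iff trunc_id)
  show "bij (trunc n g)" using 1 2 o_bij by blast
  show "inv' (trunc n g) = trunc n (inv' g)"
    using 1 2 by (simp add: inv_unique_comp)
qed

lemma section_trunc:
  "length v = n \<Longrightarrow> section_at (trunc (n + j) g) v = trunc j (section_at g v)"
  by (auto simp: section_at_def trunc_def)

lemma restrict_eqD: "restrict f A = restrict g A \<Longrightarrow> x \<in> A \<Longrightarrow> f x = g x"
  by (metis restrict_apply')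

section \<open>Finite quotients of a self-similar group\<close>

locale self_similar_group =
  fixes m :: nat and G :: "(nat list \<Rightarrow> nat list) set"
  assumes m_ge2: "2 \<le> m"
    and G_aut: "g \<in> G \<Longrightarrow> g \<in> carrier (aut_tree m)"
    and G_id: "id \<in> G"
    and G_comp: "g \<in> G \<Longrightarrow> h \<in> G \<Longrightarrow> h \<circ> g \<in> G"
    and G_inv: "g \<in> G \<Longrightarrow> inv' g \<in> G"
    and G_section: "g \<in> G \<Longrightarrow> v \<in> words m \<Longrightarrow> section_at g v \<in> G"
begin

definition quot :: "nat \<Rightarrow> (nat list \<Rightarrow> nat list) set" where
  "quot n = trunc n ` G"

lemma G_length: "g \<in> G \<Longrightarrow> length (g v) = length v"
  using G_aut aut_length by blast

lemma G_bij: "g \<in> G \<Longrightarrow> bij g"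
  using G_aut aut_permutes permutes_bij by metis

lemma trunc_comp_G: "g \<in> G \<Longrightarrow> trunc n (h \<circ> g) = trunc n h \<circ> trunc n g"
  by (rule trunc_comp) (rule G_length)

lemma trunc_inv_G:
  assumes "g \<in> G"
  shows "inv' (trunc n g) = trunc n (inv' g)" and "bij (trunc n g)"
  using trunc_inv[of g n] G_length[OF assms] G_bij[OF assms] by blast+

lemma quot_id: "id \<in> quot n"
  unfolding quot_def using G_id trunc_id by (metis image_eqI)

lemma quot_comp: "q \<in> quot n \<Longrightarrow> q' \<in> quot n \<Longrightarrow> q' \<circ> q \<in> quot n"
  unfolding quot_def by (auto simp: trunc_comp_G[symmetric] intro!: imageI G_comp)

lemma quot_inv: "q \<in> quot n \<Longrightarrow> inv' q \<in> quot n"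
  unfolding quot_def by (auto simp: trunc_inv_G intro!: imageI G_inv)

lemma quot_bij: "q \<in> quot n \<Longrightarrow> bij q"
  unfolding quot_def using trunc_inv_G(2) by blast

lemma quot_length: "q \<in> quot n \<Longrightarrow> length (q v) = length v"
  unfolding quot_def using G_length by (auto simp: trunc_def)

lemma quot_level: "q \<in> quot n \<Longrightarrow> q v \<in> level m k \<longleftrightarrow> v \<in> level m k"
  unfolding quot_def by (auto simp: trunc_def aut_level[OF G_aut] split: if_splits)

lemma quot_trunc: "q \<in> quot (n + j) \<Longrightarrow> trunc n q \<in> quot n"
  unfolding quot_def by (auto simp: trunc_trunc)

lemma trunc_level: "x \<in> level m n \<Longrightarrow> trunc n q x = q x"
  by (simp add: trunc_def level_def)

lemma quot_section: "q \<in> quot (n + j) \<Longrightarrow> x \<in> level m n \<Longrightarrow> section_at q x \<in> quot j"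
  unfolding quot_def using G_section by (auto simp: section_trunc level_def)

lemma quot_append:
  assumes "q \<in> quot (n + j)" "x \<in> level m n" "u \<in> level m j"
  shows "q (x @ u) = q x @ section_at q x u"
proof -
  obtain g where g: "g \<in> G" "q = trunc (n + j) g"
    using assms(1) by (auto simp: quot_def)
  have "g (x @ u) = g x @ section_at g x u"
    using assms G_aut[OF g(1)] by (intro section_append) (auto simp: level_def)
  then show ?thesis
    using assms(2,3) G_length[OF g(1)] by (simp add: g section_at_def trunc_def level_def)
qed

lemma level_nonempty: "level m n \<noteq> {}"
  using card_level[of m n] m_ge2 by (metis card.empty not_numeral_le_zero power_eq_0_iff)

text \<open>A shorter vertex is extended to level \<open>n\<close>; the image of the extension
  begins with the image of the vertex. All other words are fixed by every truncation.\<close>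

lemma quot_eqI:
  assumes q: "q \<in> quot n" "q' \<in> quot n" and eq: "\<And>v. v \<in> level m n \<Longrightarrow> q v = q' v"
  shows "q = q'"
proof
  fix v
  show "q v = q' v"
  proof (cases "v \<in> words m \<and> length v \<le> n")
    case True
    then have v: "v \<in> level m (length v)" by (simp add: level_def)
    obtain u where u: "u \<in> level m (n - length v)"
      using level_nonempty by blast
    have "q (v @ u) = q' (v @ u)"
      using v u True by (intro eq) (auto simp: level_def)
    then show ?thesis
      using quot_append[OF _ v u, of q] quot_append[OF _ v u, of q'] q True quot_length[OF q(1), of v] quot_length[OF q(2), of v]
      by simp
  next
    case False
    have fixed: "p v = v" if "p \<in> quot n" for p
      using that False permutes_not_in[OF aut_permutes[OF G_aut]]
      by (auto simp: quot_def trunc_def)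
    show ?thesis by (simp add: fixed q)
  qed
qed

text \<open>The image of \<open>x @ u\<close>, with \<open>x\<close> of level \<open>n\<close>, is
  the image of \<open>x\<close>, read off the truncation, followed by the value of the section at
  \<open>x\<close>.\<close>

lemma quot_inj_on:
  "inj_on (\<lambda>q. (trunc n q, \<lambda>x\<in>level m n. section_at q x)) (quot (n + j))"
proof (rule inj_onI)
  fix q q' assume q: "q \<in> quot (n + j)" "q' \<in> quot (n + j)"
    and "(trunc n q, \<lambda>x\<in>level m n. section_at q x) = (trunc n q', \<lambda>x\<in>level m n. section_at q' x)"
  then have t: "trunc n q = trunc n q'"
    and r: "(\<lambda>x\<in>level m n. section_at q x) = (\<lambda>x\<in>level m n. section_at q' x)"
    by simp_all
  have s: "section_at q x = section_at q' x" if "x \<in> level m n" for x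
    using restrict_eqD[OF r that] .
  show "q = q'"
  proof (rule quot_eqI[OF q])
    fix v assume "v \<in> level m (n + j)"
    then obtain x u where "x \<in> level m n" "u \<in> level m j" "v = x @ u"
      by (auto simp: level_append)
    then show "q v = q' v"
      using quot_append[OF q(1)] quot_append[OF q(2)] s t trunc_level by metis
  qed
qed

lemma finite_quot: "finite (quot n)"
proof -
  have "inj_on (\<lambda>q. restrict q (level m n)) (quot n)"
    by (intro inj_onI quot_eqI) (auto dest: restrict_eqD)
  moreover have "(\<lambda>q. restrict q (level m n)) ` quot n \<subseteq> level m n \<rightarrow>\<^sub>E level m n"
    using quot_level by auto
  ultimately show ?thesis
    by (meson finite_PiE finite_level_set inj_on_finite)
qed

lemma card_quot_pos: "0 < card (quot n)"
  using finite_quot quot_id card_gt_0_iff by blast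

text \<open>By \<open>quot_inj_on\<close>. Self-similarity is what puts all \<open>m ^ n\<close>
  sections into the same set \<open>quot j\<close>.\<close>

lemma card_quot_add: "card (quot (n + j)) \<le> card (quot n) * card (quot j) ^ m ^ n"
proof -
  have "card (quot (n + j)) \<le> card (quot n \<times> (level m n \<rightarrow>\<^sub>E quot j))"
    by (rule card_inj_on_le[OF quot_inj_on])
      (auto simp: quot_trunc quot_section finite_quot finite_PiE)
  then show ?thesis
    by (simp add: card_cartesian_product card_PiE card_level)
qed

section \<open>Random tuples and fixed vertices\<close>

lemma letter_act_quot:
  "f \<in> {1..r} \<rightarrow>\<^sub>E quot n \<Longrightarrow> a \<in> {1..r} \<times> UNIV \<Longrightarrow> letter_act f a \<in> quot n"
  by (auto simp: letter_act_def intro!: quot_inv)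

lemma walk_quot:
  assumes "f \<in> {1..r} \<rightarrow>\<^sub>E quot n" "set w \<subseteq> {1..r} \<times> UNIV"
  shows "walk f w \<in> quot n"
  using assms(2)
  by (induction w) (auto simp: walk_Cons quot_id intro!: quot_comp letter_act_quot[OF assms(1)])

definition trunc_tuple :: "nat \<Rightarrow> nat \<Rightarrow> (nat \<Rightarrow> nat list \<Rightarrow> nat list) \<Rightarrow> nat \<Rightarrow> nat list \<Rightarrow> nat list" where
  "trunc_tuple r n f = (\<lambda>i\<in>{1..r}. trunc n (f i))"

lemma trunc_tuple_tuples:
  "f \<in> {1..r} \<rightarrow>\<^sub>E quot (n + j) \<Longrightarrow> trunc_tuple r n f \<in> {1..r} \<rightarrow>\<^sub>E quot n"
  by (auto simp: trunc_tuple_def intro!: quot_trunc)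

lemma letter_act_trunc_tuple:
  assumes "f \<in> {1..r} \<rightarrow>\<^sub>E quot (n + j)" "a \<in> {1..r} \<times> UNIV"
  shows "letter_act (trunc_tuple r n f) a = trunc n (letter_act f a)"
proof -
  have "f (fst a) \<in> quot (n + j)" using assms by auto
  then show ?thesis
    using assms(2) trunc_inv(1)[OF quot_length quot_bij] by (auto simp: letter_act_def trunc_tuple_def)
qed

lemma walk_trunc_tuple:
  assumes "f \<in> {1..r} \<rightarrow>\<^sub>E quot (n + j)" "set w \<subseteq> {1..r} \<times> UNIV"
  shows "walk (trunc_tuple r n f) w = trunc n (walk f w)"
  using assms(2)
proof (induction w)
  case (Cons a w)
  then show ?case
    using trunc_comp[OF quot_length[OF letter_act_quot[OF assms(1), of a]], of n "walk f w"]
    by (simp add: walk_Cons letter_act_trunc_tuple[OF assms(1)] del: o_apply)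
qed simp

text \<open>The probability \<open>p n\<close> of the introduction: tuple and vertex are independent
  and uniform.\<close>

definition fix_prob :: "nat \<Rightarrow> letter list \<Rightarrow> nat \<Rightarrow> real" where
  "fix_prob r w n = (\<Sum>f\<in>{1..r} \<rightarrow>\<^sub>E quot n. real (card {v \<in> level m n. walk f w v = v}))
     / (real (card (quot n)) ^ r * real m ^ n)"

lemma card_tuples: "card ({1..r::nat} \<rightarrow>\<^sub>E quot n) = card (quot n) ^ r"
  by (simp add: card_PiE)

lemma finite_tuples: "finite ({1..r::nat} \<rightarrow>\<^sub>E quot n)"
  by (rule finite_PiE[OF finite_atLeastAtMost]) (rule finite_quot)

text \<open>Truncation is multiplicative, so composition with a lift \<open>s\<close> of
  \<open>q\<close> carries the fibre over \<open>id\<close> to the fibre over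
  \<open>q\<close>.\<close>

lemma card_fibre:
  assumes q: "q \<in> quot n"
  shows "card {q' \<in> quot (n + j). trunc n q' = q} = card {q' \<in> quot (n + j). trunc n q' = id}"
proof -
  obtain g where g: "g \<in> G" "q = trunc n g" using q by (auto simp: quot_def)
  define s where "s = trunc (n + j) g"
  have s: "s \<in> quot (n + j)" "trunc n s = q"
    using g by (auto simp: s_def quot_def trunc_trunc)
  have i: "inv' s \<in> quot (n + j)" "trunc n (inv' s) = inv' q"
    using quot_inv[OF s(1)] trunc_inv(1)[OF quot_length quot_bij, OF s(1) s(1), of n] s(2) by auto
  have b: "bij q" "bij s" using quot_bij q s by auto
  have c: "inv' s \<circ> s = id" "s \<circ> inv' s = id" "inv' q \<circ> q = id"
    using b by (auto simp: bij_is_inj bij_is_surj surj_iff[symmetric])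
  have tc: "trunc n (h \<circ> k) = trunc n h \<circ> trunc n k" if "k \<in> quot (n + j)" for h k
    using trunc_comp[OF quot_length[OF that]] .
  show ?thesis
  proof (rule bij_betw_same_card[of "\<lambda>k. inv' s \<circ> k"], rule bij_betwI[where g = "\<lambda>k. s \<circ> k"])
    show "(\<lambda>k. inv' s \<circ> k) \<in> {q' \<in> quot (n + j). trunc n q' = q} \<rightarrow> {q' \<in> quot (n + j). trunc n q' = id}"
      using i c by (auto simp: tc quot_comp)
    show "(\<lambda>k. s \<circ> k) \<in> {q' \<in> quot (n + j). trunc n q' = id} \<rightarrow> {q' \<in> quot (n + j). trunc n q' = q}"
      using s by (auto simp: tc quot_comp)
  qed (simp_all add: o_assoc c)
qed

text \<open>All fibres of \<open>trunc_tuple\<close> have the same size, so a uniform tuple stays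
  uniform under truncation.\<close>

lemma sum_trunc_tuple:
  fixes \<phi> :: "(nat \<Rightarrow> nat list \<Rightarrow> nat list) \<Rightarrow> real"
  shows "(\<Sum>f\<in>{1..r} \<rightarrow>\<^sub>E quot (n + j). \<phi> (trunc_tuple r n f)) / real (card (quot (n + j))) ^ r
       = (\<Sum>f\<in>{1..r} \<rightarrow>\<^sub>E quot n. \<phi> f) / real (card (quot n)) ^ r"
proof -
  let ?F = "\<lambda>n. {1..r} \<rightarrow>\<^sub>E quot n"
  define K where "K = card {q' \<in> quot (n + j). trunc n q' = id}"
  have fibre: "card {f \<in> ?F (n + j). trunc_tuple r n f = p} = K ^ r" if p: "p \<in> ?F n" for p
  proof -
    have "{f \<in> ?F (n + j). trunc_tuple r n f = p}
        = (\<Pi>\<^sub>E i\<in>{1..r}. {q' \<in> quot (n + j). trunc n q' = p i})"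
      using p by (auto simp: trunc_tuple_def PiE_iff extensional_def fun_eq_iff restrict_def)
    moreover have "card {q' \<in> quot (n + j). trunc n q' = p i} = K" if "i \<in> {1..r}" for i
      unfolding K_def using p that by (intro card_fibre) auto
    ultimately show ?thesis by (simp add: card_PiE)
  qed
  have gen: "(\<Sum>f\<in>?F (n + j). \<psi> (trunc_tuple r n f)) = real K ^ r * (\<Sum>f\<in>?F n. \<psi> f)" for \<psi> :: "_ \<Rightarrow> real"
  proof -
    have "(\<Sum>f\<in>?F (n + j). \<psi> (trunc_tuple r n f))
        = (\<Sum>p\<in>?F n. \<Sum>f\<in>{f \<in> ?F (n + j). trunc_tuple r n f = p}. \<psi> (trunc_tuple r n f))"
      by (rule sum.group[symmetric, OF finite_tuples finite_tuples])
        (rule image_subsetI, rule trunc_tuple_tuples)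
    also have "\<dots> = (\<Sum>p\<in>?F n. real K ^ r * \<psi> p)"
      by (rule sum.cong) (simp_all add: fibre del: One_nat_def)
    finally show ?thesis by (simp add: sum_distrib_left)
  qed
  \<comment> \<open>The constant function 1 gives the ratio of the two numbers of tuples, which
    cancels the factor \<open>K ^ r\<close>.\<close>
  have "real (card (quot (n + j))) ^ r = real K ^ r * real (card (quot n)) ^ r"
    using gen[of "\<lambda>_. 1"] by (simp add: card_tuples del: One_nat_def)
  moreover have "0 < real (card (quot (n + j))) ^ r"
    using card_quot_pos by simp
  ultimately show ?thesis
    using gen[of \<phi>] by (auto simp: zero_less_mult_iff)
qed

end

section \<open>Counting tuples with many good vertices\<close>

text \<open>A maximal disjoint subfamily works: each \<open>T v\<close> meets some
  \<open>T y\<close> with \<open>y \<in> I\<close>, and a given \<open>T y\<close> is met by at most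
  \<open>l * l\<close> of the sets, \<open>l\<close> for each of its at most \<open>l\<close>
  points.\<close>

lemma disjoint_subfamily:
  fixes T :: "'a \<Rightarrow> 'a set"
  assumes V: "finite V" and self: "\<And>v. v \<in> V \<Longrightarrow> v \<in> T v"
    and T: "\<And>v. v \<in> V \<Longrightarrow> finite (T v) \<and> card (T v) \<le> l"
    and deg: "\<And>x. card {v \<in> V. x \<in> T v} \<le> l"
  obtains I where "I \<subseteq> V" "disjoint_family_on T I" "card V \<le> l * l * card I"
proof -
  let ?A = "{I. I \<subseteq> V \<and> disjoint_family_on T I}"
  have "finite ?A" using V by simp
  moreover have "{} \<in> ?A" by (simp add: disjoint_family_on_def)
  ultimately obtain I where I: "I \<in> ?A" and max: "\<And>J. J \<in> ?A \<Longrightarrow> I \<subseteq> J \<Longrightarrow> I = J"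
    using finite_has_maximal2[of ?A "{}"] by auto
  have fI: "finite I" using I V finite_subset by blast
  have "V \<subseteq> (\<Union>y\<in>I. \<Union>x\<in>T y. {v \<in> V. x \<in> T v})"
  proof
    fix v assume v: "v \<in> V"
    show "v \<in> (\<Union>y\<in>I. \<Union>x\<in>T y. {v \<in> V. x \<in> T v})"
    proof (cases "v \<in> I")
      case True
      then show ?thesis using v self[OF v] by blast
    next
      case False
      then have "insert v I \<notin> ?A" using max[of "insert v I"] by blast
      then have "\<not> disjoint_family_on T (insert v I)" using I v by blast
      then obtain y where "y \<in> I" "T v \<inter> T y \<noteq> {}"
        using I False by (auto simp: disjoint_family_on_insert)
      then show ?thesis using v by blast
    qed
  qed
  then have "card V \<le> card (\<Union>y\<in>I. \<Union>x\<in>T y. {v \<in> V. x \<in> T v})"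
    using fI I T V by (intro card_mono) auto
  also have "\<dots> \<le> (\<Sum>y\<in>I. card (\<Union>x\<in>T y. {v \<in> V. x \<in> T v}))"
    by (rule card_UN_le[OF fI])
  also have "\<dots> \<le> (\<Sum>y\<in>I. l * l)"
  proof (rule sum_mono)
    fix y assume "y \<in> I"
    then have y: "finite (T y)" "card (T y) \<le> l" using I T by auto
    have "card (\<Union>x\<in>T y. {v \<in> V. x \<in> T v}) \<le> (\<Sum>x\<in>T y. card {v \<in> V. x \<in> T v})"
      by (rule card_UN_le[OF y(1)])
    also have "\<dots> \<le> card (T y) * l"
      using sum_bounded_above[of "T y" _ l] deg by simp
    finally show "card (\<Union>x\<in>T y. {v \<in> V. x \<in> T v}) \<le> l * l"
      using y(2) by (meson le_trans mult_le_mono1)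
  qed
  finally show thesis
    using that[of I] I by (simp add: mult.commute)
qed

section \<open>Closed orbits along a reduced word\<close>

definition orbit_simple :: "(nat \<Rightarrow> 'a \<Rightarrow> 'a) \<Rightarrow> letter list \<Rightarrow> 'a \<Rightarrow> bool" where
  "orbit_simple f w v \<longleftrightarrow> inj_on (\<lambda>t. walk f (take t w) v) {..<length w}"

text \<open>The point after the last letter is left out, here and in \<open>orbit_simple\<close>,
  because a closed orbit is back at \<open>v\<close> by then.\<close>

definition orbit :: "(nat \<Rightarrow> 'a \<Rightarrow> 'a) \<Rightarrow> letter list \<Rightarrow> 'a \<Rightarrow> 'a set" where
  "orbit f w v = (\<lambda>t. walk f (take t w) v) ` {..<length w}"

text \<open>Reading the letter \<open>a\<close> at \<open>x\<close> involves the section of \<open>f (fst a)\<close> at \<open>edge_source f a x\<close>.\<close>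

definition edge_source :: "(nat \<Rightarrow> 'a \<Rightarrow> 'a) \<Rightarrow> letter \<Rightarrow> 'a \<Rightarrow> 'a" where
  "edge_source f a x = (if snd a then x else letter_act f a x)"

lemma letter_act_inverse:
  assumes "bij (f (fst a))"
  shows "letter_act f (letter_inv a) (letter_act f a x) = x"
  using assms by (simp add: letter_act_def letter_inv_def bij_is_inj bij_is_surj surj_f_inv_f)

lemma reduced_nth:
  "reduced w \<Longrightarrow> Suc i < length w \<Longrightarrow> w ! Suc i \<noteq> letter_inv (w ! i)"
  unfolding reduced_def successively_conv_nth by blast

text \<open>Reading the first edge again in the same direction would repeat \<open>x 0\<close>.
  Reading it in the opposite direction would force \<open>x t = x 1\<close>, so \<open>t = 1\<close>
  and the first two letters would cancel. Hence a closed simple orbit uses the section read by its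
  first letter only once.\<close>

lemma first_edge_once:
  assumes w: "reduced w" and v: "orbit_simple f w v" "walk f w v = v"
    and bij: "\<And>a. a \<in> set w \<Longrightarrow> bij (f (fst a))"
    and t: "0 < t" "t < length w" and i: "fst (w ! t) = fst (w ! 0)"
    and src: "edge_source f (w ! t) (walk f (take t w) v) = edge_source f (w ! 0) v"
  shows False
proof -
  define x where "x k = walk f (take k w) v" for k
  have inj: "k = k'" if "x k = x k'" "k < length w" "k' < length w" for k k'
    using v(1) that by (auto simp: orbit_simple_def x_def inj_on_def)
  have x0: "x 0 = v" and xl: "x (length w) = v" by (simp_all add: x_def v)
  have step: "x (Suc k) = letter_act f (w ! k) (x k)" if "k < length w" for k
    using that by (simp add: x_def walk_take_Suc)
  have unstep: "x k = letter_act f (letter_inv (w ! k)) (x (Suc k))" if "k < length w" for k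
    using letter_act_inverse[of f "w ! k"] bij[of "w ! k"] that by (simp add: step)
  have first: "t \<noteq> 1" if "w ! t = letter_inv (w ! 0)"
    using reduced_nth[OF w, of 0] t that by auto
  have l: "0 < length w" "1 < length w" using t by auto
  consider "w ! t = w ! 0" | "w ! t = letter_inv (w ! 0)"
    using i by (cases "w ! t"; cases "w ! 0") (auto simp: letter_inv_def)
  then show False
  proof cases
    case 1
    then have "x t = x 0"
      using src unstep[OF t(2)] unstep[OF l(1)] x0 step[OF t(2)] step[OF l(1)]
      by (auto simp: edge_source_def x_def split: if_splits)
    then show False using inj[of t 0] t l by linarith
  next
    case 2
    show False
    proof (cases "snd (w ! 0)")
      case True
      then have "x (Suc t) = x 0"
        using src 2 step[OF t(2)] x0 by (simp add: edge_source_def letter_inv_def x_def)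
      moreover from this have "Suc t = length w"
        using inj[of "Suc t" 0] t l by linarith
      ultimately have "x t = x 1"
        using unstep[OF t(2)] 2 step[OF l(1)] by simp
      then show False using inj[of t 1] t l first[OF 2] by blast
    next
      case False
      then have "x t = x 1"
        using src 2 step[OF l(1)] x0 by (simp add: edge_source_def letter_inv_def x_def)
      then show False using inj[of t 1] t l first[OF 2] by blast
    qed
  qed
qed

section \<open>One section determined by the others\<close>

context self_similar_group
begin

text \<open>For tuples over \<open>quot (n + j)\<close> the last condition makes \<open>w\<close>
  fix \<open>v\<close> itself, as level \<open>j\<close> is nonempty, and have trivial section at
  \<open>v\<close> on \<open>j\<close> levels.\<close>

definition good :: "(nat \<Rightarrow> nat list \<Rightarrow> nat list) \<Rightarrow> letter list \<Rightarrow> nat \<Rightarrow> nat \<Rightarrow> nat list \<Rightarrow> bool" where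
  "good f w n j v \<longleftrightarrow> v \<in> level m n \<and> orbit_simple f w v \<and> (\<forall>u\<in>level m j. walk f w (v @ u) = v @ u)"

text \<open>The tail \<open>u\<close> may change at every letter, so agreement along the path of
  \<open>x\<close> is required for all tails at once.\<close>

lemma walk_agree:
  assumes f: "f \<in> {1..r} \<rightarrow>\<^sub>E quot (n + j)"
    and z: "set z \<subseteq> {1..r} \<times> UNIV" and x: "x \<in> level m n" and u: "u \<in> level m j"
    and agree: "\<And>t u. t < length z \<Longrightarrow> u \<in> level m j \<Longrightarrow>
      letter_act f (z ! t) (walk f (take t z) x @ u) = letter_act f' (z ! t) (walk f (take t z) x @ u)"
  shows "walk f z (x @ u) = walk f' z (x @ u)"
  using z x u agree
proof (induction z arbitrary: x u)
  case (Cons a z)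
  let ?q = "letter_act f a"
  have a: "?q \<in> quot (n + j)"
    using Cons.prems(1) by (intro letter_act_quot[OF f]) auto
  have qx: "?q x \<in> level m n"
    using quot_level[OF a] Cons.prems(2) by blast
  obtain u' where u': "u' \<in> level m j" "?q (x @ u) = ?q x @ u'"
    using quot_append[OF a Cons.prems(2,3)] quot_level[OF quot_section[OF a Cons.prems(2)]] Cons.prems(3)
    by blast
  have "walk f z (?q x @ u') = walk f' z (?q x @ u')"
  proof (rule Cons.IH[OF _ qx u'(1)])
    show "set z \<subseteq> {1..r} \<times> UNIV" using Cons.prems(1) by auto
    fix t u assume "t < length z" "u \<in> level m j"
    then show "letter_act f (z ! t) (walk f (take t z) (?q x) @ u) = letter_act f' (z ! t) (walk f (take t z) (?q x) @ u)"
      using Cons.prems(4)[of "Suc t" u] by (simp add: walk_Cons)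
  qed
  moreover have "letter_act f' a (x @ u) = ?q x @ u'"
    using Cons.prems(4)[of 0 u] Cons.prems(3) u' by simp
  ultimately show ?case
    by (simp add: walk_Cons u')
qed simp

text \<open>For an inverse letter, agreement of the inverses below \<open>x\<close> becomes
  agreement of the generators below the preimage of \<open>x\<close>. This preimage is the same
  vertex for both tuples because their truncations coincide.\<close>

lemma letter_act_agree_iff:
  assumes f: "f \<in> {1..r} \<rightarrow>\<^sub>E quot (n + j)" "f' \<in> {1..r} \<rightarrow>\<^sub>E quot (n + j)"
    and tr: "trunc_tuple r n f = trunc_tuple r n f'"
    and a: "a \<in> {1..r} \<times> UNIV" and x: "x \<in> level m n"
  shows "(\<forall>u\<in>level m j. letter_act f a (x @ u) = letter_act f' a (x @ u)) \<longleftrightarrow>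
    (\<forall>u\<in>level m j. f (fst a) (edge_source f a x @ u) = f' (fst a) (edge_source f a x @ u))"
proof (cases "snd a")
  case False
  let ?p = "f (fst a)" and ?p' = "f' (fst a)"
  have p: "?p \<in> quot (n + j)" "?p' \<in> quot (n + j)" using f a by auto
  have b: "bij ?p" "bij ?p'" using p quot_bij by auto
  have i: "inv' ?p \<in> quot (n + j)" "inv' ?p' \<in> quot (n + j)" using p quot_inv by auto
  have act: "letter_act f a = inv' ?p" "letter_act f' a = inv' ?p'"
    using False by (simp_all add: letter_act_def)
  have "trunc n (letter_act f a) = trunc n (letter_act f' a)"
    using letter_act_trunc_tuple[OF f(1) a] letter_act_trunc_tuple[OF f(2) a] tr by simp
  then have xx: "inv' ?p x = inv' ?p' x"
    using trunc_level[OF x] act by metis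
  define y where "y = inv' ?p x"
  have y: "y \<in> level m n" using quot_level[OF i(1)] x by (simp add: y_def)
  have yx: "?p y = x" "?p' y = x"
    using b xx unfolding y_def by (metis bij_is_surj surj_f_inv_f)+
  have "(\<forall>u\<in>level m j. inv' ?p (x @ u) = inv' ?p' (x @ u)) \<longleftrightarrow>
      (\<forall>u\<in>level m j. ?p (y @ u) = ?p' (y @ u))"
  proof (intro iffI ballI)
    fix u assume u: "u \<in> level m j" and eq: "\<forall>u\<in>level m j. inv' ?p (x @ u) = inv' ?p' (x @ u)"
    define u' where "u' = section_at ?p y u"
    have "u' \<in> level m j" "?p (y @ u) = x @ u'"
      using quot_append[OF p(1) y u] quot_level[OF quot_section[OF p(1) y]] u yx by (auto simp: u'_def)
    then show "?p (y @ u) = ?p' (y @ u)"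
      using eq b by (metis bij_inv_eq_iff)
  next
    fix u assume u: "u \<in> level m j" and eq: "\<forall>u\<in>level m j. ?p (y @ u) = ?p' (y @ u)"
    define u' where "u' = section_at (inv' ?p) x u"
    have "u' \<in> level m j" "inv' ?p (x @ u) = y @ u'"
      using quot_append[OF i(1) x u] quot_level[OF quot_section[OF i(1) x]] u by (auto simp: u'_def y_def)
    then show "inv' ?p (x @ u) = inv' ?p' (x @ u)"
      using eq b by (metis bij_inv_eq_iff)
  qed
  then show ?thesis
    using False by (simp add: act edge_source_def y_def)
qed (simp add: letter_act_def edge_source_def)

text \<open>Around the closed orbit of \<open>v\<close> the sections compose to the identity on
  \<open>j\<close> levels, so the one read first is forced by the rest. \<open>D\<close> marks this
  section for each \<open>v \<in> I\<close>, and disjointness of the orbits ensures that the rest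
  contains no section marked for another vertex.\<close>

lemma good_inj:
  fixes I r n j \<pi> w
  defines "D \<equiv> (\<lambda>v. (fst (w ! 0), edge_source \<pi> (w ! 0) v)) ` I"
  defines "X \<equiv> {f \<in> {1..r} \<rightarrow>\<^sub>E quot (n + j). trunc_tuple r n f = \<pi> \<and> (\<forall>v\<in>I. good f w n j v)
      \<and> disjoint_family_on (orbit f w) I}"
  assumes w: "reduced w" "w \<noteq> []" "set w \<subseteq> {1..r} \<times> UNIV"
  shows "inj_on (\<lambda>f. \<lambda>(i, x)\<in>{1..r} \<times> level m n - D. section_at (f i) x) X"
proof (rule inj_onI)
  fix f f' assume fX: "f \<in> X" "f' \<in> X"
    and eq: "(\<lambda>(i, x)\<in>{1..r} \<times> level m n - D. section_at (f i) x) = (\<lambda>(i, x)\<in>{1..r} \<times> level m n - D. section_at (f' i) x)"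
  have f: "f \<in> {1..r} \<rightarrow>\<^sub>E quot (n + j)" "f' \<in> {1..r} \<rightarrow>\<^sub>E quot (n + j)"
    and tr: "trunc_tuple r n f = \<pi>" "trunc_tuple r n f' = \<pi>" using fX by (auto simp: X_def)
  have trunc_eq: "trunc n (walk f z) = walk \<pi> z" "trunc n (walk f' z) = walk \<pi> z" if "set z \<subseteq> {1..r} \<times> UNIV" for z
    using walk_trunc_tuple[OF f(1) that] walk_trunc_tuple[OF f(2) that] tr by auto
  have walk_eq: "walk f z x = walk \<pi> z x" "walk f' z x = walk \<pi> z x"
    if "set z \<subseteq> {1..r} \<times> UNIV" "x \<in> level m n" for z x
    using trunc_eq[OF that(1)] trunc_level[OF that(2)] by metis+
  have src_eq: "edge_source f a x = edge_source \<pi> a x" if "a \<in> {1..r} \<times> UNIV" "x \<in> level m n" for a x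
    using walk_eq[of "[a]" x] that by (simp add: edge_source_def walk_Cons)
  have value_eq: "f i x = f' i x" if "i \<in> {1..r}" "x \<in> level m n" for i x
    using fun_cong[OF tr(1), of i] fun_cong[OF tr(2), of i] that trunc_level[OF that(2)]
    by (auto simp: trunc_tuple_def) metis
  have off: "f i (x @ u) = f' i (x @ u)"
    if "i \<in> {1..r}" "x \<in> level m n" "(i, x) \<notin> D" "u \<in> level m j" for i x u
  proof -
    have "section_at (f i) x = section_at (f' i) x"
      using restrict_eqD[OF eq, of "(i, x)"] that by simp
    moreover have "f i \<in> quot (n + j)" "f' i \<in> quot (n + j)" using f that by auto
    ultimately show ?thesis
      using quot_append that value_eq by metis
  qed
  have wt: "w ! t \<in> {1..r} \<times> UNIV" if "t < length w" for t
    using w(3) that nth_mem by blast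
  have take_w: "set (take t w) \<subseteq> {1..r} \<times> UNIV" for t
    using w(3) by (meson dual_order.trans set_take_subset)
  have on: "f (fst (w ! 0)) (edge_source f (w ! 0) v @ u) = f' (fst (w ! 0)) (edge_source f (w ! 0) v @ u)"
    if v: "v \<in> I" and u: "u \<in> level m j" for v u
  proof -
    have g: "good f w n j v" "good f' w n j v" using fX v by (auto simp: X_def)
    have vl: "v \<in> level m n" using g by (simp add: good_def)
    obtain u0 where u0: "u0 \<in> level m j" using level_nonempty by blast
    have wq: "walk f w \<in> quot (n + j)" by (rule walk_quot[OF f(1) w(3)])
    have "walk f w (v @ u0) = v @ u0" using g u0 by (simp add: good_def)
    then have closed: "walk f w v = v"
      using quot_append[OF wq vl u0] quot_length[OF wq, of v] by simp
    define x where "x t = walk f (take t w) v" for t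
    have xl: "x t \<in> level m n" for t
      using quot_level[OF walk_quot[OF f(1) take_w]] vl by (simp add: x_def)
    \<comment> \<open>The end point \<open>t = length w\<close> is included because the last letter
      may be an inverse one, and then its edge starts there.\<close>
    have x_orbit: "x t \<in> orbit f w v" if "t \<le> length w" for t
    proof (cases "t = length w")
      case True
      then have "x t = x 0" using closed by (simp add: x_def)
      moreover have "x 0 \<in> orbit f w v"
        unfolding orbit_def x_def using w(2) by (intro imageI) simp
      ultimately show ?thesis by simp
    qed (use that in \<open>auto simp: orbit_def x_def\<close>)
    have step: "x (Suc t) = letter_act f (w ! t) (x t)" if "t < length w" for t
      using that by (simp add: x_def walk_take_Suc)
    \<comment> \<open>A later edge is not the marked edge of \<open>v\<close> by
      \<open>first_edge_once\<close>, and not that of another \<open>v'\<close> because its source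
      lies in the orbit of \<open>v\<close>.\<close>
    have not_D: "(fst (w ! t), edge_source f (w ! t) (x t)) \<notin> D" if t: "0 < t" "t < length w" for t
    proof
      assume "(fst (w ! t), edge_source f (w ! t) (x t)) \<in> D"
      then obtain v' where v': "v' \<in> I" "fst (w ! t) = fst (w ! 0)"
          "edge_source f (w ! t) (x t) = edge_source \<pi> (w ! 0) v'"
        by (auto simp: D_def)
      have gv': "good f w n j v'" using fX v' by (auto simp: X_def)
      have vl': "v' \<in> level m n" using gv' by (simp add: good_def)
      have s': "edge_source \<pi> (w ! 0) v' = edge_source f (w ! 0) v'"
        using src_eq[OF wt vl', of 0] w(2) by simp
      show False
      proof (cases "v' = v")
        case True
        have "bij (f (fst a))" if "a \<in> set w" for a
          using that w(3) f(1) quot_bij by (metis PiE_mem SigmaE fst_conv subset_eq)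
        then show False
          using first_edge_once[OF w(1) _ closed _ t v'(2)] g(1) v'(3) s' True
          by (simp add: good_def x_def)
      next
        case False
        have "edge_source f (w ! t) (x t) \<in> orbit f w v"
          using x_orbit[of t] x_orbit[of "Suc t"] step t by (simp add: edge_source_def)
        moreover have "edge_source f (w ! 0) v' \<in> orbit f w v'"
        proof -
          obtain u0 where u0: "u0 \<in> level m j" using level_nonempty by blast
          have "walk f w (v' @ u0) = v' @ u0" using gv' u0 by (simp add: good_def)
          then have c': "walk f w v' = v'"
            using quot_append[OF wq vl' u0] quot_length[OF wq, of v'] by simp
          have 0: "v' \<in> orbit f w v'"
            using w(2) by (auto simp: orbit_def intro!: image_eqI[of _ _ 0])
          have "letter_act f (w ! 0) v' = walk f (take (Suc 0) w) v'"
            using w(2) by (simp add: walk_take_Suc)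
          then have "letter_act f (w ! 0) v' \<in> orbit f w v'"
            using 0 c' by (cases "length w = 1") (use w(2) in \<open>auto simp: orbit_def\<close>)
          with 0 show ?thesis by (simp add: edge_source_def)
        qed
        moreover have "orbit f w v \<inter> orbit f w v' = {}"
          using fX v v'(1) False by (simp add: X_def disjoint_family_on_def)
        ultimately show False
          using v'(3) s' by auto
      qed
    qed
    obtain a z where w': "w = a # z" using w(2) by (cases w) auto
    have a: "a \<in> {1..r} \<times> UNIV" and z: "set z \<subseteq> {1..r} \<times> UNIV" using w(3) w' by auto
    \<comment> \<open>After the first letter only unmarked sections are read, and on these the two
      tuples agree.\<close>
    have rest: "walk f z (x 1 @ u) = walk f' z (x 1 @ u)" if u: "u \<in> level m j" for u
    proof (rule walk_agree[OF f(1) z xl u])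
      fix t u assume t: "t < length z" and u: "u \<in> level m j"
      have e: "walk f (take t z) (x 1) = x (Suc t)"
        by (simp add: x_def w' walk_Cons)
      have t': "Suc t < length w" "w ! Suc t = z ! t" using t by (simp_all add: w')
      have es: "edge_source f (w ! Suc t) (x (Suc t)) \<in> level m n"
        using xl[of "Suc t"] xl[of "Suc (Suc t)"] step[OF t'(1)] by (simp add: edge_source_def)
      have "f (fst (w ! Suc t)) (edge_source f (w ! Suc t) (x (Suc t)) @ u)
          = f' (fst (w ! Suc t)) (edge_source f (w ! Suc t) (x (Suc t)) @ u)" if "u \<in> level m j" for u
        using off[OF _ es not_D that] wt[OF t'(1)] t'(1) by (metis SigmaE fst_conv zero_less_Suc)
      then show "letter_act f (z ! t) (walk f (take t z) (x 1) @ u) = letter_act f' (z ! t) (walk f (take t z) (x 1) @ u)"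
        using letter_act_agree_iff[OF f _ wt[OF t'(1)] xl[of "Suc t"]] tr u t'(2) e by simp
    qed
    have aq: "letter_act f a \<in> quot (n + j)" "letter_act f' a \<in> quot (n + j)"
      using letter_act_quot f a by auto
    have x1: "letter_act f a v = x 1" by (simp add: x_def w' walk_Cons)
    have x1': "letter_act f' a v = x 1"
      using walk_eq[of "[a]" v] a vl x1 by (simp add: walk_Cons)
    have "letter_act f a (v @ u) = letter_act f' a (v @ u)" if u: "u \<in> level m j" for u
    proof -
      obtain u1 u2 where u12: "u1 \<in> level m j" "letter_act f a (v @ u) = x 1 @ u1"
          "u2 \<in> level m j" "letter_act f' a (v @ u) = x 1 @ u2"
        using quot_append[OF aq(1) vl u] quot_append[OF aq(2) vl u] quot_level[OF quot_section[OF aq(1) vl]]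
          quot_level[OF quot_section[OF aq(2) vl]] u x1 x1' by metis
      \<comment> \<open>Both tuples return to \<open>v @ u\<close>. The remaining letters act alike
        and injectively, so the first letter must have led to the same vertex.\<close>
      have "walk f z (x 1 @ u1) = v @ u" "walk f' z (x 1 @ u2) = v @ u"
        using g u unfolding u12(2,4)[symmetric] by (simp_all add: good_def w' walk_Cons)
      then have "walk f z (x 1 @ u1) = walk f z (x 1 @ u2)"
        using rest[OF u12(3)] by simp
      then have "x 1 @ u1 = x 1 @ u2"
        using quot_bij[OF walk_quot[OF f(1) z]] by (meson bij_is_inj injD)
      then show ?thesis using u12 by simp
    qed
    then show ?thesis
      using letter_act_agree_iff[OF f _ a vl] tr u by (simp add: w')
  qed
  show "f = f'"
  proof (rule PiE_ext[OF f])
    fix i assume i: "i \<in> {1..r}"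
    have q: "f i \<in> quot (n + j)" "f' i \<in> quot (n + j)" using f i by auto
    show "f i = f' i"
    proof (rule quot_eqI[OF q])
      fix y assume "y \<in> level m (n + j)"
      then obtain x u where xu: "x \<in> level m n" "u \<in> level m j" "y = x @ u"
        by (auto simp: level_append)
      show "f i y = f' i y"
      proof (cases "(i, x) \<in> D")
        case True
        then obtain v where v: "v \<in> I" "i = fst (w ! 0)" "x = edge_source \<pi> (w ! 0) v"
          by (auto simp: D_def)
        then have "v \<in> level m n" using fX by (auto simp: X_def good_def)
        then have "x = edge_source f (w ! 0) v"
          using src_eq[OF wt] v w(2) by simp
        then show ?thesis using on[OF v(1) xu(2)] v(2) xu(3) by simp
      qed (use off i xu in simp)
    qed
  qed
qed

end

text \<open>A reverse Markov inequality: \<open>c f\<close> is at most \<open>N\<close> where it is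
  large and at most \<open>\<beta> * N\<close> elsewhere. The factor 2 in the hypothesis leaves one
  \<open>\<beta>\<close> to be spent on the small values.\<close>

lemma card_Markov:
  fixes c :: "'a \<Rightarrow> nat"
  assumes F: "finite F" and c: "\<And>f. f \<in> F \<Longrightarrow> c f \<le> N"
    and \<beta>: "0 \<le> \<beta>" "2 * \<beta> * real (card F) * real N \<le> (\<Sum>f\<in>F. real (c f))" and N: "0 < N"
  shows "\<beta> * real (card F) \<le> real (card {f \<in> F. \<beta> * real N \<le> real (c f)})"
proof -
  let ?A = "{f \<in> F. \<beta> * real N \<le> real (c f)}"
  have "(\<Sum>f\<in>F. real (c f)) \<le> (\<Sum>f\<in>F. real N * of_bool (\<beta> * real N \<le> real (c f)) + \<beta> * real N)"
    using c \<beta>(1) by (intro sum_mono) (auto intro: add_increasing2)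
  also have "\<dots> = real N * real (card ?A) + real (card F) * (\<beta> * real N)"
    using F by (simp add: sum.distrib Int_def flip: sum_distrib_left)
  finally have "(\<beta> * real (card F)) * real N \<le> real (card ?A) * real N"
    using \<beta>(2) by (simp add: algebra_simps)
  then show ?thesis using N by simp
qed

section \<open>Union bound for tuples with many good vertices\<close>

context self_similar_group
begin

lemma edge_source_level:
  "f \<in> {1..r} \<rightarrow>\<^sub>E quot n \<Longrightarrow> a \<in> {1..r} \<times> UNIV \<Longrightarrow> x \<in> level m k \<Longrightarrow> edge_source f a x \<in> level m k"
  using quot_level[OF letter_act_quot] by (auto simp: edge_source_def)

lemma inj_edge_source:
  assumes "f \<in> {1..r} \<rightarrow>\<^sub>E quot n" "a \<in> {1..r} \<times> UNIV"
  shows "inj (edge_source f a)"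
  using quot_bij[OF letter_act_quot[OF assms]] by (auto simp: edge_source_def inj_def bij_def)

text \<open>Of the \<open>r * m ^ n\<close> sections of a tuple, \<open>card I\<close> are forced by
  \<open>good_inj\<close>; each of the others has at most \<open>card (quot j)\<close>
  values.\<close>

lemma card_good_fibre:
  assumes w: "reduced w" "w \<noteq> []" "set w \<subseteq> {1..r} \<times> UNIV" and I: "I \<subseteq> level m n"
    and \<pi>: "\<pi> \<in> {1..r} \<rightarrow>\<^sub>E quot n"
  shows "card {f \<in> {1..r} \<rightarrow>\<^sub>E quot (n + j). trunc_tuple r n f = \<pi> \<and> (\<forall>v\<in>I. good f w n j v)
      \<and> disjoint_family_on (orbit f w) I} \<le> card (quot j) ^ (r * m ^ n - card I)"
    (is "card ?X \<le> _")
proof -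
  define D where "D = (\<lambda>v. (fst (w ! 0), edge_source \<pi> (w ! 0) v)) ` I"
  have w0: "w ! 0 \<in> {1..r} \<times> UNIV" using w by (metis length_greater_0_conv nth_mem subsetD)
  have D: "D \<subseteq> {1..r} \<times> level m n"
    using edge_source_level[OF \<pi> w0] I w0 by (auto simp: D_def)
  have cD: "card D = card I"
    unfolding D_def using inj_edge_source[OF \<pi> w0]
    by (intro card_image) (auto simp: inj_on_def)
  let ?E = "{1..r} \<times> level m n - D"
  have cE: "card ?E = r * m ^ n - card I"
    using D cD by (simp add: card_Diff_subset finite_subset[OF D] card_cartesian_product card_level)
  have "card ?X \<le> card (?E \<rightarrow>\<^sub>E quot j)"
  proof (rule card_inj_on_le[OF good_inj[OF w, where I = I and \<pi> = \<pi>, folded D_def]])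
    show "(\<lambda>f. \<lambda>(i, x)\<in>?E. section_at (f i) x) ` ?X \<subseteq> ?E \<rightarrow>\<^sub>E quot j"
      by (auto simp del: One_nat_def intro!: quot_section)
    show "finite (?E \<rightarrow>\<^sub>E quot j)"
      by (rule finite_PiE) (auto simp: finite_quot)
  qed
  also have "\<dots> = card (quot j) ^ (r * m ^ n - card I)"
    by (subst card_PiE) (simp_all add: cE del: One_nat_def)
  finally show ?thesis .
qed

lemma orbit_self: "w \<noteq> [] \<Longrightarrow> v \<in> orbit f w v"
  unfolding orbit_def by (intro image_eqI[of _ _ 0]) auto

text \<open>Out of \<open>length w * length w * K\<close> good vertices,
  \<open>disjoint_subfamily\<close> selects \<open>K\<close> with disjoint orbits. The count then
  sums over the truncation and the selected set. The crude factor \<open>2 ^ m ^ n\<close> for the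
  latter is affordable, since its logarithm divided by \<open>m ^ n\<close> does not depend on
  \<open>j\<close>.\<close>

lemma card_many_good:
  assumes w: "reduced w" "w \<noteq> []" "set w \<subseteq> {1..r} \<times> UNIV"
  shows "card {f \<in> {1..r} \<rightarrow>\<^sub>E quot (n + j). length w * length w * K \<le> card {v. good f w n j v}}
    \<le> card (quot n) ^ r * 2 ^ m ^ n * card (quot j) ^ (r * m ^ n - K)"
    (is "card ?X \<le> _")
proof -
  define Y where "Y \<pi> I = {f \<in> {1..r} \<rightarrow>\<^sub>E quot (n + j). trunc_tuple r n f = \<pi> \<and> (\<forall>v\<in>I. good f w n j v)
      \<and> disjoint_family_on (orbit f w) I}" for \<pi> I
  let ?J = "({1..r} \<rightarrow>\<^sub>E quot n) \<times> {I. I \<subseteq> level m n \<and> card I = K}"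
  have finY: "finite (Y \<pi> I)" for \<pi> I
    unfolding Y_def using finite_tuples by (rule rev_finite_subset) blast
  have finJ: "finite ?J" by (simp add: finite_tuples del: One_nat_def)
  have "?X \<subseteq> (\<Union>(\<pi>, I)\<in>?J. Y \<pi> I)"
  proof
    fix f assume "f \<in> ?X"
    then have f: "f \<in> {1..r} \<rightarrow>\<^sub>E quot (n + j)" and V: "length w * length w * K \<le> card {v. good f w n j v}" by auto
    let ?V = "{v. good f w n j v}"
    have VL: "?V \<subseteq> level m n" by (auto simp: good_def)
    have q: "walk f (take t w) \<in> quot (n + j)" for t
      by (rule walk_quot[OF f subset_trans[OF set_take_subset w(3)]])
    \<comment> \<open>For each time \<open>t\<close> only one starting vertex is at \<open>x\<close>
      then.\<close>
    have deg: "card {v \<in> ?V. x \<in> orbit f w v} \<le> length w" for x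
    proof -
      have "{v \<in> ?V. x \<in> orbit f w v} \<subseteq> (\<lambda>t. inv' (walk f (take t w)) x) ` {..<length w}"
      proof
        fix v assume "v \<in> {v \<in> ?V. x \<in> orbit f w v}"
        then obtain t where "t < length w" "x = walk f (take t w) v"
          by (auto simp: orbit_def)
        then show "v \<in> (\<lambda>t. inv' (walk f (take t w)) x) ` {..<length w}"
          using quot_bij[OF q, of t] by (intro image_eqI[of _ _ t]) (simp_all add: bij_is_inj)
      qed
      from surj_card_le[OF finite_lessThan this] show ?thesis by simp
    qed
    have fT: "finite (orbit f w v) \<and> card (orbit f w v) \<le> length w" for v
      unfolding orbit_def by (metis card_image_le card_lessThan finite_imageI finite_lessThan)
    obtain I where I: "I \<subseteq> ?V" "disjoint_family_on (orbit f w) I" "card ?V \<le> length w * length w * card I"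
      by (rule disjoint_subfamily[OF finite_subset[OF VL finite_level_set] orbit_self[OF w(2)] fT deg])
    have "length w * length w * K \<le> length w * length w * card I" using V I(3) by linarith
    then have "K \<le> card I" using w(2) by simp
    then obtain I' where I': "I' \<subseteq> I" "card I' = K" by (meson obtain_subset_with_card_n)
    then have "f \<in> Y (trunc_tuple r n f) I'"
      using f I disjoint_family_on_mono[OF I'(1) I(2)] by (auto simp: Y_def)
    moreover have "(trunc_tuple r n f, I') \<in> ?J"
      using trunc_tuple_tuples[OF f] I' I VL by auto
    ultimately show "f \<in> (\<Union>(\<pi>, I)\<in>?J. Y \<pi> I)" by blast
  qed
  then have "card ?X \<le> card (\<Union>(\<pi>, I)\<in>?J. Y \<pi> I)"
    using finY finJ by (intro card_mono) auto
  also have "\<dots> \<le> (\<Sum>(\<pi>, I)\<in>?J. card (Y \<pi> I))"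
    using card_UN_le[OF finJ, of "\<lambda>(\<pi>, I). Y \<pi> I"] by (simp add: case_prod_unfold)
  also have "\<dots> \<le> (\<Sum>(\<pi>, I)\<in>?J. card (quot j) ^ (r * m ^ n - K))"
  proof (rule sum_mono, clarify)
    fix \<pi> I assume "\<pi> \<in> {1..r} \<rightarrow>\<^sub>E quot n" "I \<subseteq> level m n" "K = card I"
    then show "card (Y \<pi> I) \<le> card (quot j) ^ (r * m ^ n - card I)"
      unfolding Y_def by (intro card_good_fibre[OF w])
  qed
  also have "\<dots> = card (quot n) ^ r * card {I. I \<subseteq> level m n \<and> card I = K} * card (quot j) ^ (r * m ^ n - K)"
    by (simp add: card_cartesian_product card_tuples del: One_nat_def)
  also have "\<dots> \<le> card (quot n) ^ r * 2 ^ m ^ n * card (quot j) ^ (r * m ^ n - K)"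
  proof -
    have "card {I. I \<subseteq> level m n \<and> card I = K} \<le> card (Pow (level m n))"
      by (rule card_mono) auto
    then show ?thesis by (simp add: card_Pow card_level)
  qed
  finally show ?thesis .
qed

section \<open>Expected number of good vertices\<close>

lemma card_fixed_split:
  assumes q: "q \<in> quot (n + j)"
  shows "card {y \<in> level m (n + j). q y = y}
      + card {v \<in> level m n. q v = v \<and> (\<exists>u\<in>level m j. q (v @ u) \<noteq> v @ u)}
    \<le> m ^ j * card {v \<in> level m n. q v = v}"
proof -
  let ?V = "{v \<in> level m n. q v = v}"
  have "{y \<in> level m (n + j). q y = y} \<subseteq> (\<Union>v\<in>?V. (\<lambda>u. v @ u) ` {u \<in> level m j. q (v @ u) = v @ u})"
  proof
    fix y assume "y \<in> {y \<in> level m (n + j). q y = y}"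
    then obtain v u where vu: "v \<in> level m n" "u \<in> level m j" "y = v @ u" "q (v @ u) = v @ u"
      by (auto simp: level_append)
    then have "q v = v"
      using quot_append[OF q vu(1,2)] quot_length[OF q, of v] by simp
    then show "y \<in> (\<Union>v\<in>?V. (\<lambda>u. v @ u) ` {u \<in> level m j. q (v @ u) = v @ u})"
      using vu by blast
  qed
  then have "card {y \<in> level m (n + j). q y = y} \<le> card (\<Union>v\<in>?V. (\<lambda>u. v @ u) ` {u \<in> level m j. q (v @ u) = v @ u})"
    by (intro card_mono) auto
  also have "\<dots> \<le> (\<Sum>v\<in>?V. card ((\<lambda>u. v @ u) ` {u \<in> level m j. q (v @ u) = v @ u}))"
    by (rule card_UN_le) simp
  also have "\<dots> = (\<Sum>v\<in>?V. card {u \<in> level m j. q (v @ u) = v @ u})"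
    by (intro sum.cong refl card_image) (simp add: inj_on_def)
  finally have 1: "card {y \<in> level m (n + j). q y = y} \<le> (\<Sum>v\<in>?V. card {u \<in> level m j. q (v @ u) = v @ u})" .
  have "{v \<in> level m n. q v = v \<and> (\<exists>u\<in>level m j. q (v @ u) \<noteq> v @ u)}
      = ?V \<inter> {v. \<exists>u\<in>level m j. q (v @ u) \<noteq> v @ u}" by auto
  then have 2: "card {v \<in> level m n. q v = v \<and> (\<exists>u\<in>level m j. q (v @ u) \<noteq> v @ u)}
      = (\<Sum>v\<in>?V. of_bool (\<exists>u\<in>level m j. q (v @ u) \<noteq> v @ u))"
    by simp
  \<comment> \<open>A nontrivial section costs at least one of the \<open>m ^ j\<close>
    descendants.\<close>
  have "card {u \<in> level m j. q (v @ u) = v @ u} + of_bool (\<exists>u\<in>level m j. q (v @ u) \<noteq> v @ u) \<le> m ^ j" for v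
  proof (cases "\<exists>u\<in>level m j. q (v @ u) \<noteq> v @ u")
    case True
    then have "card {u \<in> level m j. q (v @ u) = v @ u} < card (level m j)"
      by (intro psubset_card_mono) auto
    then show ?thesis by (simp add: card_level)
  next
    case False
    then have "{u \<in> level m j. q (v @ u) = v @ u} = level m j" by blast
    then show ?thesis using False by (simp add: card_level)
  qed
  then have "(\<Sum>v\<in>?V. card {u \<in> level m j. q (v @ u) = v @ u} + of_bool (\<exists>u\<in>level m j. q (v @ u) \<noteq> v @ u))
      \<le> (\<Sum>v\<in>?V. m ^ j)"
    by (rule sum_mono)
  then show ?thesis using 1 2 by (simp add: sum.distrib mult.commute)
qed

text \<open>The event concerns level \<open>n\<close> only, so the deeper levels of the tuple
  average out by \<open>sum_trunc_tuple\<close>.\<close>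

lemma fix_prob_eq:
  assumes "set w \<subseteq> {1..r} \<times> UNIV"
  shows "(\<Sum>f\<in>{1..r} \<rightarrow>\<^sub>E quot (n + j). real (card {v \<in> level m n. walk f w v = v}))
    = fix_prob r w n * (real (card (quot (n + j))) ^ r * real m ^ n)"
proof -
  have "(\<Sum>f\<in>{1..r} \<rightarrow>\<^sub>E quot (n + j). real (card {v \<in> level m n. walk f w v = v}))
    = (\<Sum>f\<in>{1..r} \<rightarrow>\<^sub>E quot (n + j). real (card {v \<in> level m n. walk (trunc_tuple r n f) w v = v}))"
  proof (intro sum.cong refl arg_cong[where f = real] arg_cong[where f = card] Collect_cong conj_cong)
    fix f v assume "f \<in> {1..r} \<rightarrow>\<^sub>E quot (n + j)" "v \<in> level m n"
    then show "walk f w v = v \<longleftrightarrow> walk (trunc_tuple r n f) w v = v"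
      using walk_trunc_tuple[of f r n j w] assms trunc_level[of v n "walk f w"] by simp
  qed
  then show ?thesis
    using sum_trunc_tuple[of "\<lambda>f. real (card {v \<in> level m n. walk f w v = v})" r n j]
      card_quot_pos[of n] card_quot_pos[of "n + j"] m_ge2
    by (simp add: fix_prob_def field_simps del: One_nat_def)
qed

text \<open>This is \<open>card_fixed_split\<close> averaged over all tuples. The factor
  \<open>real m ^ j\<close> appears because a fixed vertex with nontrivial section may lose just one
  descendant out of \<open>m ^ j\<close>.\<close>

lemma fix_prob_drop:
  assumes w: "set w \<subseteq> {1..r} \<times> UNIV"
  shows "(\<Sum>f\<in>{1..r} \<rightarrow>\<^sub>E quot (n + j).
      real (card {v \<in> level m n. walk f w v = v \<and> (\<exists>u\<in>level m j. walk f w (v @ u) \<noteq> v @ u)}))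
    \<le> real m ^ j * (fix_prob r w n - fix_prob r w (n + j)) * (real (card (quot (n + j))) ^ r * real m ^ n)"
proof -
  have "(\<Sum>f\<in>{1..r} \<rightarrow>\<^sub>E quot (n + j). real (card {y \<in> level m (n + j). walk f w y = y})
      + real (card {v \<in> level m n. walk f w v = v \<and> (\<exists>u\<in>level m j. walk f w (v @ u) \<noteq> v @ u)}))
    \<le> (\<Sum>f\<in>{1..r} \<rightarrow>\<^sub>E quot (n + j). real m ^ j * real (card {v \<in> level m n. walk f w v = v}))"
  proof (rule sum_mono)
    fix f assume "f \<in> {1..r} \<rightarrow>\<^sub>E quot (n + j)"
    from card_fixed_split[OF walk_quot[OF this w]]
    show "real (card {y \<in> level m (n + j). walk f w y = y})
      + real (card {v \<in> level m n. walk f w v = v \<and> (\<exists>u\<in>level m j. walk f w (v @ u) \<noteq> v @ u)})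
      \<le> real m ^ j * real (card {v \<in> level m n. walk f w v = v})"
      by (simp only: of_nat_add[symmetric] of_nat_mult[symmetric] of_nat_power[symmetric] of_nat_le_iff)
  qed
  then show ?thesis
    using fix_prob_eq[OF w, of n j] fix_prob_eq[OF w, of "n + j" 0]
    by (simp add: sum.distrib power_add algebra_simps del: One_nat_def flip: sum_distrib_left)
qed

text \<open>A repetition at times \<open>s < t\<close> means that the subword between them fixes the
  vertex reached at time \<open>s\<close>. As \<open>t < length w\<close>, this subword is shorter
  than \<open>w\<close>, which suits an induction on the length.\<close>

lemma card_not_simple:
  assumes f: "f \<in> {1..r} \<rightarrow>\<^sub>E quot N" and w: "set w \<subseteq> {1..r} \<times> UNIV"
  shows "card {v \<in> level m n. \<not> orbit_simple f w v}
    \<le> (\<Sum>(s, t)\<in>{(s, t). s < t \<and> t < length w}. card {v \<in> level m n. walk f (drop s (take t w)) v = v})"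
proof -
  let ?P = "{(s, t). s < t \<and> t < length w}"
  let ?S = "\<lambda>(s, t). {v \<in> level m n. walk f (take s w) v = walk f (take t w) v}"
  have finP: "finite ?P"
    by (rule finite_subset[of _ "{..<length w} \<times> {..<length w}"]) auto
  have q: "walk f (take t w) \<in> quot N" for t
    by (rule walk_quot[OF f subset_trans[OF set_take_subset w]])
  have "{v \<in> level m n. \<not> orbit_simple f w v} \<subseteq> (\<Union>p\<in>?P. ?S p)"
  proof
    fix v assume v: "v \<in> {v \<in> level m n. \<not> orbit_simple f w v}"
    then obtain s t where "walk f (take s w) v = walk f (take t w) v" "s < length w" "t < length w" "s \<noteq> t"
      by (auto simp: orbit_simple_def inj_on_def)
    then obtain s t where "walk f (take s w) v = walk f (take t w) v" "s < t" "t < length w"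
      by (metis linorder_neqE_nat)
    then show "v \<in> (\<Union>p\<in>?P. ?S p)" using v by auto
  qed
  then have "card {v \<in> level m n. \<not> orbit_simple f w v} \<le> card (\<Union>p\<in>?P. ?S p)"
    using finP by (intro card_mono) auto
  also have "\<dots> \<le> (\<Sum>p\<in>?P. card (?S p))"
    by (rule card_UN_le[OF finP])
  also have "\<dots> \<le> (\<Sum>(s, t)\<in>?P. card {v \<in> level m n. walk f (drop s (take t w)) v = v})"
  proof (rule sum_mono, clarify)
    fix s t assume st: "s < t" "t < length w"
    then have "take t w = take s w @ drop s (take t w)"
      by (metis append_take_drop_id less_imp_le min.absorb1 take_take)
    then have e: "walk f (take t w) v = walk f (drop s (take t w)) (walk f (take s w) v)" for v
      using walk_append[of f "take s w" "drop s (take t w)"] by simp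
    show "card {v \<in> level m n. walk f (take s w) v = walk f (take t w) v}
      \<le> card {v \<in> level m n. walk f (drop s (take t w)) v = v}"
    proof (rule card_inj_on_le)
      show "inj_on (walk f (take s w)) {v \<in> level m n. walk f (take s w) v = walk f (take t w) v}"
        using quot_bij[OF q[of s]] bij_is_inj inj_on_subset by blast
      show "walk f (take s w) ` {v \<in> level m n. walk f (take s w) v = walk f (take t w) v}
        \<subseteq> {v \<in> level m n. walk f (drop s (take t w)) v = v}"
      proof (rule image_subsetI)
        fix v assume "v \<in> {v \<in> level m n. walk f (take s w) v = walk f (take t w) v}"
        then show "walk f (take s w) v \<in> {v \<in> level m n. walk f (drop s (take t w)) v = v}"
          using quot_level[OF q[of s], of v n] e[of v] by simp
      qed
    qed simp
  qed
  finally show ?thesis .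
qed

text \<open>A fixed vertex is good, or has a nontrivial section on \<open>j\<close> levels, or has
  an orbit with a repetition; \<open>fix_prob_drop\<close> and \<open>card_not_simple\<close> bound
  the last two kinds.\<close>

lemma sum_good:
  assumes w: "set w \<subseteq> {1..r} \<times> UNIV"
  shows "(fix_prob r w n - real m ^ j * (fix_prob r w n - fix_prob r w (n + j))
      - (\<Sum>(s, t)\<in>{(s, t). s < t \<and> t < length w}. fix_prob r (drop s (take t w)) n))
      * (real (card (quot (n + j))) ^ r * real m ^ n)
    \<le> (\<Sum>f\<in>{1..r} \<rightarrow>\<^sub>E quot (n + j). real (card {v. good f w n j v}))"
proof -
  let ?F = "{1..r} \<rightarrow>\<^sub>E quot (n + j)" and ?P = "{(s, t). s < t \<and> t < length w}"
  let ?bad = "\<lambda>f. {v \<in> level m n. walk f w v = v \<and> (\<exists>u\<in>level m j. walk f w (v @ u) \<noteq> v @ u)}"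
  let ?C = "real (card (quot (n + j))) ^ r * real m ^ n"
  have sub: "set (drop s (take t w)) \<subseteq> {1..r} \<times> UNIV" for s t
    by (rule subset_trans[OF set_drop_subset subset_trans[OF set_take_subset w]])
  have "(\<Sum>f\<in>?F. real (card {v \<in> level m n. walk f w v = v}))
    \<le> (\<Sum>f\<in>?F. real (card {v. good f w n j v}) + real (card (?bad f))
        + (\<Sum>(s, t)\<in>?P. real (card {v \<in> level m n. walk f (drop s (take t w)) v = v})))"
  proof (rule sum_mono)
    fix f assume f: "f \<in> ?F"
    have "card {v \<in> level m n. walk f w v = v}
      \<le> card ({v. good f w n j v} \<union> ?bad f \<union> {v \<in> level m n. \<not> orbit_simple f w v})"
      by (rule card_mono) (auto simp: good_def)
    also have "\<dots> \<le> card {v. good f w n j v} + card (?bad f) + card {v \<in> level m n. \<not> orbit_simple f w v}"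
      by (meson add_le_mono1 card_Un_le dual_order.trans)
    also have "\<dots> \<le> card {v. good f w n j v} + card (?bad f)
      + (\<Sum>(s, t)\<in>?P. card {v \<in> level m n. walk f (drop s (take t w)) v = v})"
      using card_not_simple[OF f w] by simp
    finally have "real (card {v \<in> level m n. walk f w v = v}) \<le> real (card {v. good f w n j v} + card (?bad f)
      + (\<Sum>(s, t)\<in>?P. card {v \<in> level m n. walk f (drop s (take t w)) v = v}))"
      by (rule of_nat_mono)
    then show "real (card {v \<in> level m n. walk f w v = v}) \<le> real (card {v. good f w n j v}) + real (card (?bad f))
        + (\<Sum>(s, t)\<in>?P. real (card {v \<in> level m n. walk f (drop s (take t w)) v = v}))"
      by (simp add: case_prod_unfold)
  qed
  also have "\<dots> = (\<Sum>f\<in>?F. real (card {v. good f w n j v})) + (\<Sum>f\<in>?F. real (card (?bad f)))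
      + (\<Sum>(s, t)\<in>?P. \<Sum>f\<in>?F. real (card {v \<in> level m n. walk f (drop s (take t w)) v = v}))"
    by (simp add: sum.distrib sum.swap[of _ ?F] case_prod_unfold del: One_nat_def)
  also have "(\<Sum>(s, t)\<in>?P. \<Sum>f\<in>?F. real (card {v \<in> level m n. walk f (drop s (take t w)) v = v}))
      = (\<Sum>(s, t)\<in>?P. fix_prob r (drop s (take t w)) n) * ?C"
    by (simp add: fix_prob_eq[OF sub] sum_distrib_right case_prod_unfold del: One_nat_def)
  finally show ?thesis
    using fix_prob_drop[OF w, of n j] fix_prob_eq[OF w, of n j]
    by (simp add: algebra_simps del: One_nat_def)
qed

end

section \<open>Growth of the truncations\<close>

lemma reduced_sub: "reduced w \<Longrightarrow> reduced (drop s (take t w))"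
  unfolding reduced_def by (metis append_take_drop_id successively_append_iff)

context self_similar_group
begin

text \<open>For nontrivial \<open>H\<close> the logarithm of the level index of the whole group
  grows like a constant times \<open>m ^ n\<close>, whence the normalization.\<close>

definition log_growth :: "nat \<Rightarrow> real" where
  "log_growth n = ln (real (card (quot n))) / real m ^ n"

lemma ln_card_quot_nonneg: "0 \<le> ln (real (card (quot n)))"
  using card_quot_pos[of n] by simp

text \<open>The sequence itself may increase. Adding \<open>a / m ^ n\<close> makes it decrease:
  this absorbs the factor \<open>card (quot 1)\<close> of the recursion, since
  \<open>2 * a \<le> m * a\<close>.\<close>

lemma log_growth_converges:
  obtains l where "0 \<le> l" "log_growth \<longlonglongrightarrow> l"
proof -
  define a where "a = ln (real (card (quot 1)))"
  define c where "c n = log_growth n + a / real m ^ n" for n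
  have a: "0 \<le> a" by (simp add: a_def ln_card_quot_nonneg)
  have "c (Suc n) \<le> c n" for n
  proof -
    have "real (card (quot (Suc n))) \<le> real (card (quot 1)) * real (card (quot n)) ^ m"
      using card_quot_add[of 1 n] by (metis of_nat_le_iff of_nat_mult of_nat_power plus_1_eq_Suc power_one_right)
    then have "ln (real (card (quot (Suc n)))) \<le> ln (real (card (quot 1)) * real (card (quot n)) ^ m)"
      using card_quot_pos by simp
    also have "\<dots> = a + real m * ln (real (card (quot n)))"
      using card_quot_pos[of n] card_quot_pos[of 1] by (simp add: ln_mult ln_realpow a_def)
    finally have "ln (real (card (quot (Suc n)))) + a \<le> 2 * a + real m * ln (real (card (quot n)))" by simp
    also have "\<dots> \<le> real m * (ln (real (card (quot n))) + a)"
      using a m_ge2 mult_right_mono[of 2 "real m" a] by (simp add: algebra_simps)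
    finally have "(ln (real (card (quot (Suc n)))) + a) / real m ^ Suc n
        \<le> real m * (ln (real (card (quot n))) + a) / real m ^ Suc n"
      by (rule divide_right_mono) simp
    then show ?thesis
      using m_ge2 by (simp add: c_def log_growth_def flip: add_divide_distrib)
  qed
  then have dec: "decseq c" by (rule decseq_SucI)
  have c0: "0 \<le> c n" for n
    using a ln_card_quot_nonneg[of n] by (simp add: c_def log_growth_def)
  obtain l where l: "c \<longlonglongrightarrow> l"
    using decseq_convergent[OF dec, of 0] c0 by blast
  have "(\<lambda>n. a / real m ^ n) \<longlonglongrightarrow> 0"
    using m_ge2 by (intro LIMSEQ_divide_realpow_zero) auto
  from tendsto_diff[OF l this] have "log_growth \<longlonglongrightarrow> l"
    by (simp add: c_def)
  moreover have "0 \<le> l"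
    by (rule LIMSEQ_le_const[OF l]) (use c0 in blast)
  ultimately show thesis using that by blast
qed

lemma fix_prob_nonneg: "0 \<le> fix_prob r w n"
  unfolding fix_prob_def by (intro divide_nonneg_nonneg sum_nonneg) auto

lemma fix_prob_le_1: "fix_prob r w n \<le> 1"
proof -
  have "(\<Sum>f\<in>{1..r} \<rightarrow>\<^sub>E quot n. real (card {v \<in> level m n. walk f w v = v}))
      \<le> (\<Sum>f\<in>{1..r} \<rightarrow>\<^sub>E quot n. real m ^ n)"
  proof (rule sum_mono)
    fix f
    have "card {v \<in> level m n. walk f w v = v} \<le> card (level m n)" by (rule card_mono) auto
    then show "real (card {v \<in> level m n. walk f w v = v}) \<le> real m ^ n"
      by (simp add: card_level flip: of_nat_power)
  qed
  then show ?thesis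
    using card_quot_pos[of n] m_ge2 by (simp add: fix_prob_def card_tuples del: One_nat_def)
qed

lemma fix_prob_antimono:
  assumes "set w \<subseteq> {1..r} \<times> UNIV"
  shows "fix_prob r w (n + j) \<le> fix_prob r w n"
proof -
  have "0 \<le> real m ^ j * (fix_prob r w n - fix_prob r w (n + j)) * (real (card (quot (n + j))) ^ r * real m ^ n)"
    by (rule order_trans[OF sum_nonneg fix_prob_drop[OF assms]]) simp
  moreover have "0 < real m ^ j" "0 < real (card (quot (n + j))) ^ r * real m ^ n"
    using card_quot_pos[of "n + j"] m_ge2 by auto
  ultimately show ?thesis
    by (simp add: zero_le_mult_iff)
qed

text \<open>The limit in \<open>n\<close> is taken for fixed \<open>j\<close>, so that
  \<open>m ^ j\<close> times the drop of \<open>fix_prob\<close> vanishes; only then does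
  \<open>j\<close> grow. The induction on the length serves the proper subwords in
  \<open>S\<close>.\<close>

lemma fix_prob_tendsto_0:
  assumes \<mu>: "log_growth \<longlonglongrightarrow> \<mu>" "0 < \<mu>"
    and w: "reduced w" "w \<noteq> []" "set w \<subseteq> {1..r} \<times> UNIV"
  shows "fix_prob r w \<longlonglongrightarrow> 0"
  using w
proof (induction w rule: length_induct)
  case (1 w)
  note w = 1(2-4)
  let ?P = "{(s, t). s < t \<and> t < length w}"
  define S where "S n = (\<Sum>(s, t)\<in>?P. fix_prob r (drop s (take t w)) n)" for n
  have "S \<longlonglongrightarrow> (\<Sum>(s, t)\<in>?P. 0)"
    unfolding S_def
  proof (rule tendsto_sum, clarify)
    fix s t assume st: "s < t" "t < length w"
    have "set (drop s (take t w)) \<subseteq> {1..r} \<times> UNIV"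
      by (rule subset_trans[OF set_drop_subset subset_trans[OF set_take_subset w(3)]])
    then show "fix_prob r (drop s (take t w)) \<longlonglongrightarrow> 0"
      using 1(1) st reduced_sub[OF w(1)] by simp
  qed
  then have S: "S \<longlonglongrightarrow> 0" by simp
  have "decseq (fix_prob r w)"
    using fix_prob_antimono[OF w(3), of _ 1] by (intro decseq_SucI) simp
  then obtain p where p: "fix_prob r w \<longlonglongrightarrow> p" "\<And>n. p \<le> fix_prob r w n"
    using decseq_convergent[of "fix_prob r w" 0] fix_prob_nonneg by metis
  have "p \<le> 0"
  proof (rule ccontr)
    assume "\<not> p \<le> 0"
    then have p0: "0 < p" by simp
    have p1: "p \<le> 1" using p(2) fix_prob_le_1 order_trans by blast
    have r: "1 \<le> r" using w(2,3) by (cases w) auto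
    have lw: "0 < length w" using w(2) by simp
    \<comment> \<open>\<open>p / 4\<close> is the \<open>\<beta>\<close> of
      \<open>card_Markov\<close>, and the square of the length is the loss in
      \<open>disjoint_subfamily\<close>.\<close>
    define c where "c = p / (4 * (real (length w))\<^sup>2)"
    have c0: "0 < c" using p0 lw by (simp add: c_def)
    define a where "a n = ln (real (card (quot n)))" for n
    have a_eq: "a n = real m ^ n * log_growth n" for n
      using m_ge2 by (simp add: a_def log_growth_def)
    have a0: "0 \<le> a n" for n by (simp add: a_def ln_card_quot_nonneg)
    have m0: "0 < real m ^ n" for n using m_ge2 by simp
    have main: "real r * real m ^ j * \<mu> \<le> real r * \<mu> + ln 2 + (real r - c) * a j" for j
    proof -
      \<comment> \<open>The proportion of good pairs guaranteed by \<open>sum_good\<close>. It tends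
        to \<open>p\<close>, and the threshold \<open>p / 2\<close> is twice the
        \<open>\<beta>\<close> above.\<close>
      let ?\<phi> = "\<lambda>n. fix_prob r w n - real m ^ j * (fix_prob r w n - fix_prob r w (n + j)) - S n"
      have "?\<phi> \<longlonglongrightarrow> p - real m ^ j * (p - p) - 0"
        by (intro tendsto_intros p(1) S LIMSEQ_ignore_initial_segment)
      then have ev: "\<forall>\<^sub>F n in sequentially. p / 2 < ?\<phi> n"
        using p0 by (intro order_tendstoD(1)) auto
      have "ln (p / 4) / real m ^ n + real r * real m ^ j * log_growth (n + j)
          \<le> real r * log_growth n + ln 2 + (real r - c) * a j + a j / real m ^ n"
        if n: "p / 2 < ?\<phi> n" for n
      proof -
        let ?F = "{1..r} \<rightarrow>\<^sub>E quot (n + j)"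
        let ?g = "\<lambda>f. card {v. good f w n j v}"
        define K where "K = nat \<lfloor>c * real m ^ n\<rfloor>"
        have K: "real K \<le> c * real m ^ n" "c * real m ^ n - 1 \<le> real K"
          using c0 m0[of n] unfolding K_def by (simp_all add: of_nat_nat)
        have "p / 2 * (real (card (quot (n + j))) ^ r * real m ^ n) \<le> (\<Sum>f\<in>?F. real (?g f))"
          using sum_good[OF w(3), of n j] n
          by (elim order_trans[rotated]) (intro mult_right_mono, auto simp: S_def)
        then have "p / 4 * real (card ?F) \<le> real (card {f \<in> ?F. p / 4 * real (m ^ n) \<le> real (?g f)})"
        proof (intro card_Markov)
          show "finite ?F" by (rule finite_tuples)
          show "?g f \<le> m ^ n" for f
            unfolding card_level[symmetric] by (rule card_mono) (auto simp: good_def)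
        qed (use p0 m_ge2 in \<open>auto simp: card_tuples simp del: One_nat_def\<close>)
        also have "\<dots> \<le> real (card {f \<in> ?F. length w * length w * K \<le> ?g f})"
        proof (intro of_nat_mono card_mono)
          have "real (length w * length w * K) \<le> p / 4 * real (m ^ n)"
            using K(1) lw by (simp add: c_def field_simps power2_eq_square)
          then show "{f \<in> ?F. p / 4 * real (m ^ n) \<le> real (?g f)} \<subseteq> {f \<in> ?F. length w * length w * K \<le> ?g f}"
            by (auto simp del: of_nat_mult of_nat_power One_nat_def intro: of_nat_le_iff[THEN iffD1, OF order_trans])
        qed (use finite_tuples in \<open>auto simp del: One_nat_def\<close>)
        also have "\<dots> \<le> real (card (quot n) ^ r * 2 ^ m ^ n * card (quot j) ^ (r * m ^ n - K))"
          by (rule of_nat_mono[OF card_many_good[OF w]])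
        finally have "p / 4 * real (card (quot (n + j))) ^ r
            \<le> real (card (quot n)) ^ r * 2 ^ m ^ n * real (card (quot j)) ^ (r * m ^ n - K)"
          by (simp add: card_tuples del: One_nat_def)
        then have "ln (p / 4 * real (card (quot (n + j))) ^ r)
            \<le> ln (real (card (quot n)) ^ r * 2 ^ m ^ n * real (card (quot j)) ^ (r * m ^ n - K))"
          using p0 card_quot_pos by simp
        moreover have "ln (p / 4 * real (card (quot (n + j))) ^ r) = ln (p / 4) + real r * a (n + j)"
          using p0 card_quot_pos[of "n + j"] by (subst ln_mult) (simp_all add: ln_realpow a_def)
        ultimately have "ln (p / 4) + real r * a (n + j)
            \<le> real r * a n + real (m ^ n) * ln 2 + real (r * m ^ n - K) * a j"
          using card_quot_pos[of n] card_quot_pos[of j]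
          by (simp add: ln_mult ln_realpow a_def)
        \<comment> \<open>Rounding \<open>K\<close> down costs at most one further factor
          \<open>card (quot j)\<close>, whose logarithm becomes negligible after division by
          \<open>m ^ n\<close>.\<close>
        also have "real (r * m ^ n - K) * a j \<le> ((real r - c) * real m ^ n + 1) * a j"
        proof (rule mult_right_mono[OF _ a0])
          \<comment> \<open>From \<open>c \<le> 1 \<le> r\<close> follows
            \<open>K \<le> r * m ^ n\<close>, so the subtraction of naturals is exact.\<close>
          have "p / (4 * (real (length w))\<^sup>2) \<le> 1 / 1"
            using p0 p1 lw by (intro frac_le) (auto simp: Suc_le_eq intro: order_trans[of _ 4])
          then have "c * real m ^ n \<le> real r * real m ^ n"
            using r by (intro mult_right_mono) (auto simp: c_def)
          then have "real K \<le> real (r * m ^ n)" using K(1) by simp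
          then have "K \<le> r * m ^ n" by (simp only: of_nat_le_iff)
          then show "real (r * m ^ n - K) \<le> (real r - c) * real m ^ n + 1"
            using K(2) by (simp add: of_nat_diff algebra_simps)
        qed
        finally have "ln (p / 4) + real r * a (n + j)
            \<le> real r * a n + real m ^ n * ln 2 + ((real r - c) * real m ^ n + 1) * a j" by simp
        moreover have "A / M + R * B * x \<le> R * y + L + (R - c) * z + z / M"
          if "A + R * (M * B * x) \<le> R * (M * y) + M * L + ((R - c) * M + 1) * z" "0 < M"
          for A M R B x y L z :: real
          using divide_right_mono[OF that(1), of M] that(2)
          by (simp add: add_divide_distrib diff_divide_distrib ring_distribs mult.assoc)
        ultimately show ?thesis
          using m0[of n] by (simp add: a_eq[of "n + j"] a_eq[of n] power_add)
      qed
      then have ev': "\<forall>\<^sub>F n in sequentially. ln (p / 4) / real m ^ n + real r * real m ^ j * log_growth (n + j)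
          \<le> real r * log_growth n + ln 2 + (real r - c) * a j + a j / real m ^ n"
        by (rule eventually_mono[OF ev])
      have z: "(\<lambda>n. x / real m ^ n) \<longlonglongrightarrow> 0" for x
        using m_ge2 by (intro LIMSEQ_divide_realpow_zero) auto
      have "0 + real r * real m ^ j * \<mu> \<le> real r * \<mu> + ln 2 + (real r - c) * a j + 0"
        by (rule tendsto_le[OF sequentially_bot _ _ ev'])
          (intro tendsto_intros z \<mu>(1) LIMSEQ_ignore_initial_segment)+
      then show ?thesis by simp
    qed
    \<comment> \<open>Dividing by \<open>m ^ j\<close> and letting \<open>j\<close> grow leaves
      \<open>r * \<mu> \<le> (r - c) * \<mu>\<close>.\<close>
    have "real r * \<mu> \<le> (real r * \<mu> + ln 2) / real m ^ j + (real r - c) * log_growth j" for j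
      using divide_right_mono[OF main[of j], of "real m ^ j"] m_ge2
      by (simp add: a_eq add_divide_distrib)
    moreover have "(\<lambda>j. (real r * \<mu> + ln 2) / real m ^ j + (real r - c) * log_growth j) \<longlonglongrightarrow> 0 + (real r - c) * \<mu>"
      using m_ge2 by (intro tendsto_intros \<mu>(1) LIMSEQ_divide_realpow_zero) auto
    ultimately have "real r * \<mu> \<le> 0 + (real r - c) * \<mu>"
      by (intro LIMSEQ_le_const) auto
    then have "c * \<mu> \<le> 0" by (simp add: algebra_simps)
    then show False using c0 \<mu>(2) by (simp add: mult_le_0_iff)
  qed
  moreover have "0 \<le> p"
    by (rule LIMSEQ_le_const[OF p(1)]) (use fix_prob_nonneg in blast)
  ultimately show ?case using p(1) by simp
qed

text \<open>The law passes from \<open>G\<close> to each \<open>quot n\<close>, so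
  \<open>fix_prob\<close> is constantly 1; if \<open>log_growth\<close> had a positive limit, it
  would tend to 0.\<close>

lemma log_growth_law:
  assumes w: "reduced w" "w \<noteq> []" "set w \<subseteq> {1..r} \<times> UNIV"
    and law: "\<And>f. f \<in> {1..r} \<rightarrow>\<^sub>E G \<Longrightarrow> walk f w = id"
  shows "log_growth \<longlonglongrightarrow> 0"
proof -
  obtain l where l: "0 \<le> l" "log_growth \<longlonglongrightarrow> l" by (rule log_growth_converges)
  have walk_id: "walk f w = id" if f: "f \<in> {1..r} \<rightarrow>\<^sub>E quot n" for f n
  proof -
    \<comment> \<open>The tuple is lifted to \<open>G\<close>, where the law can be applied.\<close>
    have "\<forall>i\<in>{1..r}. \<exists>g\<in>G. f i = trunc n g" using f by (auto simp: quot_def)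
    then obtain g where g: "\<forall>i\<in>{1..r}. g i \<in> G \<and> f i = trunc n (g i)" by metis
    define g' where "g' = restrict g {1..r}"
    have G: "g' i \<in> G" "f i = trunc n (g' i)" if "i \<in> {1..r}" for i using g that by (auto simp: g'_def)
    have g'w: "walk f z = trunc n (walk g' z) \<and> walk g' z \<in> G" if "set z \<subseteq> {1..r} \<times> UNIV" for z
      using that
    proof (induction z)
      case (Cons a z)
      then have a: "fst a \<in> {1..r}" and IH: "walk f z = trunc n (walk g' z)" "walk g' z \<in> G" by auto
      have la: "letter_act f a = trunc n (letter_act g' a)" "letter_act g' a \<in> G"
        using G[OF a] G_inv trunc_inv_G(1) by (auto simp: letter_act_def)
      then show ?case using IH by (simp add: walk_Cons trunc_comp_G G_comp del: o_apply)
    qed (simp add: G_id)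
    have "walk g' w = id" by (rule law) (use G in \<open>auto simp: g'_def\<close>)
    then show ?thesis using g'w[OF w(3)] by simp
  qed
  have "fix_prob r w = (\<lambda>_. 1)"
    using card_quot_pos m_ge2
    by (simp add: fun_eq_iff fix_prob_def walk_id card_level card_tuples del: One_nat_def)
  then have "fix_prob r w \<longlonglongrightarrow> 1" by simp
  then have "\<not> fix_prob r w \<longlonglongrightarrow> 0" using LIMSEQ_unique by fastforce
  then have "\<not> 0 < l" using fix_prob_tendsto_0[OF l(2) _ w] by blast
  then show ?thesis using l by simp
qed

end

section \<open>Hausdorff dimension\<close>

context Metric_space
begin

text \<open>Only positive exponents need testing, because the infimum over them is already 0. A
  finite cover with a common bound on the diameters is padded with empty sets, which contribute
  0.\<close>

lemma hausdorff_dim_eq_0I: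
  assumes S: "S \<subseteq> M"
    and cover: "\<And>s \<epsilon> \<delta>. 0 < s \<Longrightarrow> 0 < \<epsilon> \<Longrightarrow> 0 < \<delta> \<Longrightarrow>
      \<exists>\<U> b. finite \<U> \<and> S \<subseteq> \<Union>\<U> \<and> 0 \<le> b \<and> b \<le> \<delta> \<and> (\<forall>U\<in>\<U>. U \<subseteq> M \<and> (\<forall>x\<in>U. \<forall>y\<in>U. d x y \<le> b)) \<and>
        real (card \<U>) * b powr s \<le> \<epsilon>"
  shows "hausdorff_dim S = 0"
proof -
  have measure_0: "hausdorff_measure s S = 0" if s: "0 < s" for s
  proof -
    have approx: "(INF U\<in>hausdorff_covers \<delta> S. \<Sum>i. diam_power s (U i)) \<le> 0 + ennreal \<epsilon>"
      if \<delta>: "0 < \<delta>" and \<epsilon>: "0 < \<epsilon>" for \<delta> \<epsilon>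
    proof -
      from cover[OF s \<epsilon> \<delta>] obtain \<U> b where C: "finite \<U> \<and> S \<subseteq> \<Union>\<U> \<and> 0 \<le> b \<and> b \<le> \<delta> \<and>
          (\<forall>U\<in>\<U>. U \<subseteq> M \<and> (\<forall>x\<in>U. \<forall>y\<in>U. d x y \<le> b)) \<and> real (card \<U>) * b powr s \<le> \<epsilon>"
        by (elim exE)
      then have \<U>: "finite \<U>" "S \<subseteq> \<Union>\<U>" and b: "0 \<le> b" "b \<le> \<delta>" and sum: "real (card \<U>) * b powr s \<le> \<epsilon>"
        by simp_all
      have diam: "d x y \<le> b" if "U \<in> \<U>" "x \<in> U" "y \<in> U" for U x y
        using C that by simp
      have \<U>M: "U \<subseteq> M" if "U \<in> \<U>" for U
        using C that by simp
      obtain e where e: "bij_betw e {..<card \<U>} \<U>"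
        using \<U>(1) ex_bij_betw_nat_finite atLeast0LessThan by metis
      define U where "U i = (if i < card \<U> then e i else {})" for i
      have U: "U i \<in> \<U>" if "i < card \<U>" for i
        using that e by (auto simp: U_def bij_betw_def)
      have ediam: "ediam (U i) \<le> ennreal b" for i
        using diam[OF U] by (auto simp: ediam_def U_def intro!: SUP_least ennreal_leI)
      have pow: "diam_power s (U i) \<le> ennreal (b powr s)" for i
      proof -
        have "enn2real (ediam (U i)) \<le> b"
          using enn2real_mono[OF ediam] b by simp
        then show ?thesis
          using s by (auto simp: diam_power_def intro!: ennreal_leI powr_mono2)
      qed
      have "U \<in> hausdorff_covers \<delta> S"
      proof -
        have "U i \<subseteq> M" for i using \<U>M[OF U] by (auto simp: U_def)
        moreover have "ediam (U i) \<le> ennreal \<delta>" for i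
          using ediam order_trans ennreal_leI[OF b(2)] by blast
        moreover have "\<Union>\<U> \<subseteq> (\<Union>i. U i)"
        proof
          fix x assume "x \<in> \<Union>\<U>"
          then obtain V where V: "V \<in> \<U>" "x \<in> V" by blast
          then obtain i where "i < card \<U>" "V = e i"
            using e unfolding bij_betw_def by auto
          then show "x \<in> (\<Union>i. U i)" using V(2) by (auto simp: U_def intro!: exI[of _ i])
        qed
        ultimately show ?thesis using \<U>(2) by (auto simp: hausdorff_covers_def)
      qed
      then have "(INF U\<in>hausdorff_covers \<delta> S. \<Sum>i. diam_power s (U i)) \<le> (\<Sum>i. diam_power s (U i))"
        by (rule INF_lower)
      also have "\<dots> = (\<Sum>i<card \<U>. diam_power s (U i))"
        by (rule suminf_finite) (auto simp: U_def diam_power_def)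
      also have "\<dots> \<le> (\<Sum>i<card \<U>. ennreal (b powr s))"
        by (rule sum_mono) (rule pow)
      also have "\<dots> = ennreal (real (card \<U>) * b powr s)"
        by (simp add: ennreal_mult ennreal_of_nat_eq_real_of_nat)
      also have "\<dots> \<le> ennreal \<epsilon>" using sum by (rule ennreal_leI)
      finally show ?thesis by simp
    qed
    have "(INF U\<in>hausdorff_covers \<delta> S. \<Sum>i. diam_power s (U i)) \<le> 0" if "0 < \<delta>" for \<delta>
      by (rule ennreal_le_epsilon) (rule approx[OF that])
    then have "hausdorff_measure s S \<le> 0"
      unfolding hausdorff_measure_def by (intro SUP_least) simp
    then show ?thesis by simp
  qed
  have "hausdorff_dim S \<le> 0 + ennreal s" if "0 < s" for s
    unfolding hausdorff_dim_def add_0_left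
    by (rule Inf_lower) (use that measure_0[OF that] in auto)
  then have "hausdorff_dim S \<le> 0" by (rule ennreal_le_epsilon)
  then show ?thesis by simp
qed

end

section \<open>Lower bound for the level index\<close>

definition branch_aut :: "nat \<Rightarrow> (nat \<Rightarrow> nat) \<Rightarrow> nat \<Rightarrow> nat list set \<Rightarrow> nat list \<Rightarrow> nat list" where
  "branch_aut m \<sigma> n A v = (if v \<in> words m \<and> n < length v \<and> take n v \<in> A then v[n := \<sigma> (v ! n)] else v)"

lemma words_update: "v \<in> words m \<Longrightarrow> x \<in> {1..m} \<Longrightarrow> v[n := x] \<in> words m"
  unfolding words_def using set_update_subset_insert[of v n x] by auto

lemma branch_aut_words:
  assumes "\<sigma> permutes {1..m}"
  shows "v \<in> words m \<Longrightarrow> branch_aut m \<sigma> n A v \<in> words m"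
proof -
  assume v: "v \<in> words m"
  have "v[n := \<sigma> (v ! n)] \<in> words m" if "n < length v"
  proof (rule words_update[OF v])
    have "v ! n \<in> {1..m}" using v that nth_mem[OF that] unfolding words_def by blast
    then show "\<sigma> (v ! n) \<in> {1..m}" by (simp only: permutes_in_image[OF assms])
  qed
  then show ?thesis using v by (simp add: branch_aut_def)
qed

text \<open>The change of the letter at position \<open>n\<close> depends only on the prefix up to
  it, so extending a word by one letter extends its image by one letter. The inverse permutation
  gives the inverse map; adjacency is proved for all permutations in order to cover both
  directions.\<close>

lemma branch_aut_in_aut_tree:
  assumes \<sigma>: "\<sigma> permutes {1..m}"
  shows "branch_aut m \<sigma> n A \<in> carrier (aut_tree m)"
proof -
  have inv: "branch_aut m (inv' \<tau>) n A (branch_aut m \<tau> n A v) = v" if \<tau>: "\<tau> permutes {1..m}" for \<tau> v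
    using branch_aut_words[OF \<tau>, of v n A] permutes_inverses(2)[OF \<tau>]
    by (auto simp: branch_aut_def split: if_splits)
  have "bij_betw (branch_aut m \<sigma> n A) (words m) (words m)"
  proof (rule bij_betwI[where g = "branch_aut m (inv' \<sigma>) n A"])
    show "branch_aut m \<sigma> n A (branch_aut m (inv' \<sigma>) n A v) = v" for v
      using inv[OF permutes_inv[OF \<sigma>]] \<sigma> by (simp add: permutes_inv_inv)
  qed (use inv[OF \<sigma>] branch_aut_words \<sigma> permutes_inv[OF \<sigma>] in auto)
  then have "branch_aut m \<sigma> n A permutes words m"
    by (intro bij_imp_permutes) (auto simp: branch_aut_def)
  moreover have adj: "tree_adjacent (branch_aut m \<tau> n A u) (branch_aut m \<tau> n A v)"
    if \<tau>: "\<tau> permutes {1..m}" and "u \<in> words m" "v \<in> words m" "tree_adjacent u v" for \<tau> u v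
  proof -
    have ext: "\<exists>y. branch_aut m \<tau> n A (z @ [x]) = branch_aut m \<tau> n A z @ [y]" if "z @ [x] \<in> words m" for z x
      using that by (auto simp: branch_aut_def list_update_append nth_append)
    show ?thesis
      using that ext unfolding tree_adjacent_def by metis
  qed
  moreover have "tree_adjacent u v" if "u \<in> words m" "v \<in> words m"
    "tree_adjacent (branch_aut m \<sigma> n A u) (branch_aut m \<sigma> n A v)" for u v
    using adj[OF permutes_inv[OF \<sigma>] _ _ that(3)] branch_aut_words[OF \<sigma>] that inv[OF \<sigma>] by simp
  ultimately show ?thesis
    using \<sigma> by (auto simp: aut_tree_def branch_aut_def[of m \<sigma> n A "[]"])
qed

text \<open>The label is \<open>\<sigma>\<close> at the vertices of \<open>A\<close> of length
  \<open>n\<close> and the identity at all others.\<close>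

lemma branch_aut_in_wreath:
  assumes H: "subgroup H (sym_group m)" and \<sigma>: "\<sigma> \<in> H"
  shows "branch_aut m \<sigma> n A \<in> carrier (iterated_wreath m H)"
proof -
  have p: "\<sigma> permutes {1..m}"
    using subgroup.subset[OF H] \<sigma> by (auto simp: sym_group_def)
  have one: "id \<in> H"
    using subgroup.one_closed[OF H] by (simp add: sym_group_def)
  have "level1_perm (section_at (branch_aut m \<sigma> n A) v) \<in> {\<sigma>, id}" if v: "v \<in> words m" for v
  proof (cases "length v = n \<and> v \<in> A")
    case True
    then have "level1_perm (section_at (branch_aut m \<sigma> n A) v) x = \<sigma> x" for x
      using v permutes_not_in[OF p, of x]
      by (auto simp: level1_perm_def section_at_def branch_aut_def words_def)
    then show ?thesis by auto
  next
    case False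
    then have "level1_perm (section_at (branch_aut m \<sigma> n A) v) x = x" for x
      by (auto simp: level1_perm_def section_at_def branch_aut_def list_update_append)
    then show ?thesis by (auto simp: fun_eq_iff)
  qed
  then show ?thesis
    using branch_aut_in_aut_tree[OF p] one \<sigma> by (force simp: iterated_wreath_def)
qed

text \<open>Different subsets \<open>A\<close> of level \<open>n\<close> give different cosets: with
  \<open>x\<close> moved by \<open>\<sigma>\<close>, the vertex \<open>v @ [x]\<close> is moved
  exactly when \<open>v \<in> A\<close>. The resulting bound has the right order on the logarithmic
  scale.\<close>

lemma level_index_ge:
  assumes H: "subgroup H (sym_group m)" and \<sigma>: "\<sigma> \<in> H" "\<sigma> \<noteq> id"
  shows "2 ^ m ^ n \<le> level_index m H (Suc n)"
proof -
  let ?W = "iterated_wreath m H"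
  let ?S = "level_stab m (carrier ?W) (Suc n)"
  let ?c = "\<lambda>A. ?S #>\<^bsub>?W\<^esub> branch_aut m \<sigma> n A"
  interpret W: group ?W by (rule group_iterated_wreath[OF H])
  have p: "\<sigma> permutes {1..m}"
    using subgroup.subset[OF H] \<sigma> by (auto simp: sym_group_def)
  obtain x where x: "\<sigma> x \<noteq> x" using \<sigma>(2) by fastforce
  then have xm: "x \<in> {1..m}" using permutes_not_in[OF p] by blast
  have carr: "branch_aut m \<sigma> n A \<in> carrier ?W" for A by (rule branch_aut_in_wreath[OF H \<sigma>(1)])
  have "inj_on ?c (Pow (level m n))"
  proof (rule inj_onI)
    fix A B assume A: "A \<in> Pow (level m n)" and B: "B \<in> Pow (level m n)" and eq: "?c A = ?c B"
    have "branch_aut m \<sigma> n A \<in> ?c B"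
      using W.rcos_self[OF carr subgroup_level_stab[OF H]] eq by blast
    then obtain s where s: "s \<in> ?S" "branch_aut m \<sigma> n A = branch_aut m \<sigma> n B \<circ> s"
      by (auto simp: r_coset_def iterated_wreath_def aut_tree_def)
    have "v \<in> A \<longleftrightarrow> v \<in> B" if v: "v \<in> level m n" for v
    proof -
      have vx: "v @ [x] \<in> words m" "length (v @ [x]) = Suc n"
        using v xm by (auto simp: level_def words_def)
      then have "s (v @ [x]) = v @ [x]" using s(1) by (simp add: level_stab_def del: words_append)
      then have "branch_aut m \<sigma> n A (v @ [x]) = branch_aut m \<sigma> n B (v @ [x])"
        using s(2) by simp
      then show ?thesis
        using vx x by (auto simp: branch_aut_def list_update_append split: if_splits)
    qed
    then show "A = B" using A B by blast
  qed
  then have "card (?c ` Pow (level m n)) = 2 ^ m ^ n"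
    by (simp add: card_image card_Pow card_level)
  moreover have "?c ` Pow (level m n) \<subseteq> rcosets\<^bsub>?W\<^esub> ?S"
    using carr by (auto simp: RCOSETS_def)
  moreover have "finite (rcosets\<^bsub>?W\<^esub> ?S)"
    using level_index_pos[OF H, of "Suc n"] by (simp add: level_index_def card_gt_0_iff)
  ultimately show ?thesis
    unfolding level_index_def by (metis card_mono)
qed

text \<open>Trivial labels fix words letter by letter. This case is kept apart because
  \<open>level_index_ge\<close> asks for a nontrivial \<open>\<sigma>\<close>.\<close>

lemma iterated_wreath_trivial:
  assumes H: "H = {id}" and g: "g \<in> carrier (iterated_wreath m H)"
  shows "g = id"
proof -
  have aut: "g \<in> carrier (aut_tree m)" and l1: "\<And>v. v \<in> words m \<Longrightarrow> level1_perm (section_at g v) = id"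
    using g H by (auto simp: iterated_wreath_def)
  have "g v = v" if "v \<in> words m" for v
    using that
  proof (induction v rule: rev_induct)
    case Nil
    then show ?case using aut by (simp add: aut_tree_def)
  next
    case (snoc x v)
    then have vx: "v \<in> words m" "[x] \<in> words m" by auto
    have "length (section_at g v [x]) = 1"
      using aut_tree_length[OF section_in_aut_tree[OF aut vx(1)] vx(2)] by simp
    moreover have "hd (section_at g v [x]) = x"
      using fun_cong[OF l1[OF vx(1)], of x] by (simp add: level1_perm_def)
    ultimately have "section_at g v [x] = [x]"
      by (cases "section_at g v [x]") auto
    then show ?case using section_append[OF aut vx] snoc.IH[OF vx(1)] by simp
  qed
  then show ?thesis
    using permutes_not_in[OF aut_permutes[OF aut]] by (metis eq_id_iff)
qed

lemma level_dist_le: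
  assumes H: "subgroup H (sym_group m)" and g: "g \<in> carrier (iterated_wreath m H)" "h \<in> carrier (iterated_wreath m H)"
    and eq: "\<And>v. v \<in> level m n \<Longrightarrow> g v = h v"
  shows "level_dist m H g h \<le> inverse (real (level_index m H n))"
proof -
  let ?W = "iterated_wreath m H"
  interpret W: group ?W by (rule group_iterated_wreath[OF H])
  define k where "k = g \<otimes>\<^bsub>?W\<^esub> inv\<^bsub>?W\<^esub> h"
  have mult: "x \<otimes>\<^bsub>?W\<^esub> y = y \<circ> x" for x y
    by (simp add: iterated_wreath_def aut_tree_def)
  have "k \<otimes>\<^bsub>?W\<^esub> h = g" using g by (simp add: k_def W.m_assoc)
  then have "h (k v) = g v" for v unfolding mult by (metis o_apply)
  moreover have "inj h" using g(2) aut_permutes permutes_inj by (auto simp: iterated_wreath_def)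
  ultimately have "k v = v" if "v \<in> level m n" for v using eq[OF that] by (metis injD)
  then have "k \<in> level_stab m (carrier ?W) n"
    using g unfolding level_stab_def level_def k_def by simp
  then have "Inf {inverse (real (level_index m H n)) | n. k \<in> level_stab m (carrier ?W) n} \<le> inverse (real (level_index m H n))"
    by (intro cInf_lower) (auto intro!: bdd_belowI[of _ 0])
  then show ?thesis by (auto simp: level_dist_def Let_def k_def)
qed

section \<open>From zero growth to dimension zero\<close>

theorem corollary5:
  fixes m :: nat and H :: "(nat \<Rightarrow> nat) set" and G :: "(nat list \<Rightarrow> nat list) set"
  assumes "2 \<le> m"
    and "subgroup H (sym_group m)"
    and "subgroup G (iterated_wreath m H)"
    and "self_similar m G"
    and "satisfies_group_law ((iterated_wreath m H)\<lparr>carrier := G\<rparr>)"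
  shows "Metric_space.hausdorff_dim (carrier (iterated_wreath m H)) (level_dist m H) G = 0"
proof -
  let ?W = "iterated_wreath m H"
  note H = assms(2)
  interpret W: group ?W by (rule group_iterated_wreath[OF H])
  interpret M: Metric_space "carrier ?W" "level_dist m H"
    using assms(1) by (intro Metric_space_level_dist H) simp
  have GW: "G \<subseteq> carrier ?W" by (rule subgroup.subset[OF assms(3)])
  have Gaut: "g \<in> carrier (aut_tree m)" if "g \<in> G" for g
    using that GW by (auto simp: iterated_wreath_def)
  have mult: "g \<otimes>\<^bsub>?W\<^esub> h = h \<circ> g" and one: "\<one>\<^bsub>?W\<^esub> = id" for g h
    by (simp_all add: iterated_wreath_def aut_tree_def)
  have inv: "inv\<^bsub>?W\<^esub> g = inv' g" if g: "g \<in> G" for g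
  proof -
    have "g \<in> carrier ?W" using g GW by blast
    then have "inv\<^bsub>?W\<^esub> g \<circ> g = id" "g \<circ> inv\<^bsub>?W\<^esub> g = id"
      using W.r_inv[of g] W.l_inv[of g] by (simp_all add: mult one)
    then show ?thesis using inv_unique_comp by metis
  qed
  interpret G: self_similar_group m G
  proof
    show "section_at g v \<in> G" if "g \<in> G" "v \<in> words m" for g v
      using assms(4) that by (simp add: self_similar_def)
    show "inv' g \<in> G" if "g \<in> G" for g
      using subgroup.m_inv_closed[OF assms(3) that] inv[OF that] by simp
    show "h \<circ> g \<in> G" if "g \<in> G" "h \<in> G" for g h
      using subgroup.m_closed[OF assms(3) that] by (simp add: mult)
  qed (use assms(1) Gaut subgroup.one_closed[OF assms(3)] one in auto)
  let ?GG = "?W\<lparr>carrier := G\<rparr>"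
  obtain r w where w: "reduced w" "w \<noteq> []" "set w \<subseteq> {1..r} \<times> UNIV"
    and law: "\<And>f. f \<in> {1..r} \<rightarrow> G \<Longrightarrow> word_eval ?GG f w = id"
    using assms(5) by (auto simp: satisfies_group_law_def free_group_def one)
  have inv': "inv\<^bsub>?GG\<^esub> g = inv' g" if "g \<in> G" for g
    using W.m_inv_consistent[OF assms(3) that] inv[OF that] by simp
  \<comment> \<open>The group product is composition in reverse order, so \<open>word_eval\<close>
    lets the first letter act first, as \<open>walk\<close> does.\<close>
  have eval: "word_eval ?GG f z = walk f z" if f: "f \<in> {1..r} \<rightarrow> G" and "set z \<subseteq> {1..r} \<times> UNIV" for f z
    using that(2)
  proof (induction z)
    case (Cons a z)
    then have "f (fst a) \<in> G" using f by auto
    then show ?case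
      using Cons by (auto simp: word_eval_def walk_Cons letter_act_def mult inv' case_prod_unfold)
  qed (simp add: word_eval_def one)
  have growth: "G.log_growth \<longlonglongrightarrow> 0"
  proof (rule G.log_growth_law[OF w])
    fix f assume "f \<in> {1..r} \<rightarrow>\<^sub>E G"
    then have "f \<in> {1..r} \<rightarrow> G" by blast
    then show "walk f w = id" using law eval w(3) by metis
  qed
  show ?thesis
  proof (rule M.hausdorff_dim_eq_0I[OF GW])
    fix s \<epsilon> \<delta> :: real assume s: "0 < s" and \<epsilon>: "0 < \<epsilon>" and \<delta>: "0 < \<delta>"
    show "\<exists>\<U> b. finite \<U> \<and> G \<subseteq> \<Union>\<U> \<and> 0 \<le> b \<and> b \<le> \<delta> \<and>
        (\<forall>U\<in>\<U>. U \<subseteq> carrier ?W \<and> (\<forall>x\<in>U. \<forall>y\<in>U. level_dist m H x y \<le> b)) \<and>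
        real (card \<U>) * b powr s \<le> \<epsilon>"
    \<comment> \<open>For trivial \<open>H\<close> the level indices do not grow, but
      \<open>G\<close> is a single point and covers itself with diameter 0.\<close>
    proof (cases "H = {id}")
      case True
      then have "x = y" if "x \<in> G" "y \<in> G" for x y
        using that iterated_wreath_trivial GW by (metis subsetD)
      then have "level_dist m H x y \<le> 0" if "x \<in> G" "y \<in> G" for x y
        using that by (auto simp: level_dist_def)
      then show ?thesis
        using \<delta> \<epsilon> s GW by (intro exI[of _ "{G}"] exI[of _ 0]) auto
    next
      case False
      obtain \<sigma> where \<sigma>: "\<sigma> \<in> H" "\<sigma> \<noteq> id"
        using False subgroup.one_closed[OF H] by (auto simp: sym_group_def)
      define I where "I n = real (level_index m H n)" for n
      define q where "q n = real (card (G.quot n))" for n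
      have I: "2 ^ m ^ n \<le> I (Suc n)" for n
        unfolding I_def using of_nat_mono[OF level_index_ge[OF H \<sigma>, of n], where 'a = real] by simp
      have I0: "0 < I n" for n unfolding I_def using level_index_pos[OF H] by simp
      have q0: "0 < q n" for n unfolding q_def using G.card_quot_pos by simp
      have mn: "filterlim (\<lambda>n. real m ^ n) at_top sequentially"
        using assms(1)
        by (intro filterlim_at_infinity_imp_filterlim_at_top filterlim_realpow_sequentially_gt1) auto
      \<comment> \<open>Since \<open>k \<le> 2 ^ k\<close>, the diameters of the truncation classes
        tend to 0.\<close>
      have bound1: "inverse (I (Suc n)) \<le> inverse (real m ^ n)" for n
      proof -
        have "real m ^ n \<le> 2 ^ m ^ n"
          using of_nat_less_two_power[of "m ^ n", where 'a = real] by simp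
        also have "\<dots> \<le> I (Suc n)" by (rule I)
        finally show ?thesis using assms(1) by (intro le_imp_inverse_le) auto
      qed
      \<comment> \<open>The left side bounds the \<open>s\<close>-sum of the cover by truncation
        classes of level \<open>Suc n\<close>. The exponent on the right tends to minus infinity,
        because \<open>log_growth\<close> tends to 0 while \<open>s * ln 2\<close> is a positive
        constant.\<close>
      have bound2: "q (Suc n) * inverse (I (Suc n)) powr s
          \<le> exp (real m ^ n * (real m * G.log_growth (Suc n) - s * ln 2))" for n
      proof -
        have "q (Suc n) = exp (real m ^ Suc n * G.log_growth (Suc n))"
          using q0[of "Suc n"] assms(1) by (simp add: G.log_growth_def q_def)
        moreover have "inverse (I (Suc n)) powr s \<le> inverse (2 ^ m ^ n) powr s"
          using I[of n] I0[of "Suc n"] s by (intro powr_mono2) (auto intro: le_imp_inverse_le)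
        moreover have "inverse (2 ^ m ^ n) powr s = exp (- (s * (real m ^ n * ln 2)))"
          by (simp add: powr_def ln_inverse ln_realpow)
        ultimately have "q (Suc n) * inverse (I (Suc n)) powr s \<le> exp (real m ^ Suc n * G.log_growth (Suc n)) * exp (- (s * (real m ^ n * ln 2)))"
          by (metis exp_ge_zero mult_left_mono)
        then show ?thesis by (simp add: algebra_simps flip: exp_add)
      qed
      have "(\<lambda>n. inverse (real m ^ n)) \<longlonglongrightarrow> 0"
        using mn by (rule tendsto_inverse_0_at_top)
      then have e1: "\<forall>\<^sub>F n in sequentially. inverse (real m ^ n) < \<delta>"
        using \<delta> by (rule order_tendstoD)
      have "(\<lambda>n. real m * G.log_growth (Suc n) - s * ln 2) \<longlonglongrightarrow> real m * 0 - s * ln 2"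
        by (intro tendsto_intros LIMSEQ_Suc growth)
      from filterlim_tendsto_neg_mult_at_bot[OF this _ mn] have "filterlim (\<lambda>n. real m ^ n * (real m * G.log_growth (Suc n) - s * ln 2)) at_bot sequentially"
        using s by (simp add: mult.commute)
      then have "((\<lambda>n. exp (real m ^ n * (real m * G.log_growth (Suc n) - s * ln 2))) \<longlonglongrightarrow> 0)"
        by (rule filterlim_compose[OF exp_at_bot])
      then have e2: "\<forall>\<^sub>F n in sequentially. exp (real m ^ n * (real m * G.log_growth (Suc n) - s * ln 2)) < \<epsilon>"
        using \<epsilon> by (rule order_tendstoD)
      obtain n where n: "inverse (real m ^ n) < \<delta>"
          "exp (real m ^ n * (real m * G.log_growth (Suc n) - s * ln 2)) < \<epsilon>"
        using eventually_happens[OF eventually_conj[OF e1 e2]] by auto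
      \<comment> \<open>Two elements of one class agree on level \<open>Suc n\<close>, so
        \<open>level_dist_le\<close> bounds their distance by \<open>?b\<close>.\<close>
      let ?U = "\<lambda>p. {g \<in> G. trunc (Suc n) g = p}"
      let ?b = "inverse (I (Suc n))"
      have "card (?U ` G.quot (Suc n)) \<le> card (G.quot (Suc n))"
        by (rule card_image_le[OF G.finite_quot])
      then have "real (card (?U ` G.quot (Suc n))) * ?b powr s \<le> q (Suc n) * ?b powr s"
        by (intro mult_right_mono) (auto simp: q_def)
      then have "real (card (?U ` G.quot (Suc n))) * ?b powr s \<le> \<epsilon>"
        using bound2[of n] n(2) by linarith
      moreover have "level_dist m H g h \<le> ?b" if "g \<in> ?U p" "h \<in> ?U p" for g h p
        unfolding I_def
      proof (rule level_dist_le[OF H])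
        show "g v = h v" if "v \<in> level m (Suc n)" for v
          using G.trunc_level[OF that] \<open>g \<in> ?U p\<close> \<open>h \<in> ?U p\<close> by (metis (mono_tags) mem_Collect_eq)
      qed (use that GW in auto)
      moreover have "G \<subseteq> \<Union>(?U ` G.quot (Suc n))"
        by (auto simp: G.quot_def)
      moreover have "?b \<le> \<delta>" using bound1[of n] n(1) by linarith
      moreover have "0 \<le> ?b" using I0[of "Suc n"] by simp
      ultimately show ?thesis
        using GW G.finite_quot[of "Suc n"]
        by (intro exI[of _ "?U ` G.quot (Suc n)"] exI[of _ ?b]) auto
    qed
  qed
qed

end
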